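(* For every integer $n\geq 3$, \[ c_5(n)=\frac{L^*_3(n;\sigma_5)}{2}-\sum_{i=2}^{n-1}i\cdot\Lambda(n,i), \] where $\sigma_5=++-$.
   Context: $\mathcal S_n$ is the set of permutations of $[n]$ in one-line notation $\pi=\pi_1\cdots\pi_n$; $\mathcal C_n$ is the set of cyclic permutations (single $n$-cycle) in $\mathcal S_n$. For $\sigma=\sigma^0\cdots\sigma^{k-1}\in\{+,-\}^k$, $\mathcal S^\sigma_n$ is the set of $\pi\in\mathcal S_n$ for which there exist $0=e_0\le e_1\le\cdots\le e_k=n$ with each segment $\pi_{e_i+1}\cdots\pi_{e_{i+1}}$ increasing if $\sigma^i=+$ and decreasing if $\sigma^i=-$; $\mathcal C_n^\sigma=\mathcal C_n\cap\mathcal S_n^\sigma$. $c_5(n)=|\mathcal C_n^{++-}|$. $\Lambda(n,i)$ is the number of $\pi\in\mathcal C_n^{+-}$ (cyclic unimodal permutations) with $\pi_i=n$. A word of length $m$ on $k$ letters is $s=s_1\cdots s_m$ with $s_j\in\{0,\dots,k-1\}$; primitive means not of the form $q^r$ with $r>1$. Necklaces are rotation classes of words, primitive if their representatives are. $L_k(m)$ is the number of primitive necklaces of length $m$ on $k$ letters. With $T_\sigma^-=\{i:\sigma^i=-\}$ and $o_\sigma(s)=|\{j:s_j\in T_\sigma^-\}|$, $L_k(m;\sigma)$ is the number of primitive necklaces of length $m$ on $k$ letters with $o_\sigma(s)$ odd ($0$ if $m$ is not an integer), and $L_k^*(n;\sigma)=L_k(n)+L_k(\tfrac n2;\sigma)$.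 *)

theory Defs
  imports Complex_Main
begin

(* A permutation of [n] in one-line notation is a list xs with xs!(j-1) = pi_j. *)
definition perms :: "nat \<Rightarrow> nat list set" where
  "perms n = {xs. length xs = n \<and> distinct xs \<and> set xs = {1..n}}"

definition perm_fun :: "nat list \<Rightarrow> nat \<Rightarrow> nat" where
  "perm_fun xs i = xs ! (i - 1)"

definition cyclic_perms :: "nat \<Rightarrow> nat list set" where
  "cyclic_perms n = {xs \<in> perms n. {(perm_fun xs ^^ k) 1 | k. True} = {1..n}}"

(* sign patterns: True = '+', False = '-' *)
definition segment :: "nat list \<Rightarrow> nat \<Rightarrow> nat \<Rightarrow> nat list" where
  "segment xs a b = take (b - a) (drop a xs)"

definition shape_perms :: "bool list \<Rightarrow> nat \<Rightarrow> nat list set" where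
  "shape_perms \<sigma> n = {xs \<in> perms n. \<exists>e :: nat \<Rightarrow> nat.
      e 0 = 0 \<and> e (length \<sigma>) = n \<and> (\<forall>i < length \<sigma>. e i \<le> e (Suc i)) \<and>
      (\<forall>i < length \<sigma>.
         (if \<sigma> ! i then sorted_wrt (<) (segment xs (e i) (e (Suc i)))
          else sorted_wrt (>) (segment xs (e i) (e (Suc i)))))}"

definition cyclic_shape_perms :: "bool list \<Rightarrow> nat \<Rightarrow> nat list set" where
  "cyclic_shape_perms \<sigma> n = cyclic_perms n \<inter> shape_perms \<sigma> n"

definition c5 :: "nat \<Rightarrow> nat" where
  "c5 n = card (cyclic_shape_perms [True, True, False] n)"

definition Lambda :: "nat \<Rightarrow> nat \<Rightarrow> nat" where
  "Lambda n i = card {xs \<in> cyclic_shape_perms [True, False] n. perm_fun xs i = n}"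

definition words :: "nat \<Rightarrow> nat \<Rightarrow> nat list set" where
  "words k m = {s. length s = m \<and> set s \<subseteq> {0..<k}}"

definition primitive :: "nat list \<Rightarrow> bool" where
  "primitive s \<longleftrightarrow> \<not> (\<exists>q r. r > 1 \<and> s = concat (replicate r q))"

definition necklace :: "nat list \<Rightarrow> nat list set" where
  "necklace s = {rotate j s | j. True}"

definition prim_necklaces :: "nat \<Rightarrow> nat \<Rightarrow> nat list set set" where
  "prim_necklaces k m = necklace ` {s \<in> words k m. primitive s}"

definition L :: "nat \<Rightarrow> nat \<Rightarrow> nat" where
  "L k m = card (prim_necklaces k m)"

definition o_sigma :: "bool list \<Rightarrow> nat list \<Rightarrow> nat" where
  "o_sigma \<sigma> s = length (filter (\<lambda>c. c \<in> {i. i < length \<sigma> \<and> \<not> \<sigma> ! i}) s)"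

definition L_sigma :: "nat \<Rightarrow> nat \<Rightarrow> bool list \<Rightarrow> nat" where
  "L_sigma k m \<sigma> = card (necklace ` {s \<in> words k m. primitive s \<and> odd (o_sigma \<sigma> s)})"

definition L_star :: "nat \<Rightarrow> nat \<Rightarrow> bool list \<Rightarrow> nat" where
  "L_star k n \<sigma> = L k n + (if even n then L_sigma k (n div 2) \<sigma> else 0)"

end

theory Submission
  imports Defs
begin

text \<open>
  The pairs of a cyclic permutation \<open>\<pi>\<close> and a \<open>++-\<close> segmentation of it are counted in two ways.

  Labelling the orbit \<open>1, \<pi> 1, \<pi>\<^sup>2 1, \<dots>\<close> by the segments it visits gives a cyclic word, and the order of
  two orbit points is determined by comparing the words that start there, the comparison being
  reversed by each common letter of the decreasing segment. A period \<open>d < n\<close> of the word with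
  an even number of such letters would give an infinite increasing sequence of orbit points, so every
  proper period is odd. Hence the word is primitive, or of the form \<open>qq\<close> with \<open>q\<close> primitive and odd, and
  conversely each such necklace comes from exactly one pair. So there are \<open>L\<^sup>*\<close> pairs.

  On the other hand, a unimodal \<open>\<pi>\<close> with peak at \<open>i\<close> has \<open>i\<close>, \<open>i + 1\<close> and \<open>1\<close> segmentations whose
  decreasing part starts after \<open>i - 1\<close>, \<open>i\<close> and \<open>i + 1\<close>, while any other \<open>\<pi>\<close> of shape \<open>++-\<close> has exactly two.
  So there are \<open>2 c\<^sub>5 + \<Sum>\<^sub>i 2 i \<Lambda>(n, i)\<close> pairs.
\<close>

section \<open>Periodic sequences, ranks and numerals\<close>

lemma periodic_mult:
  fixes f :: "nat \<Rightarrow> 'a"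
  assumes "\<And>t. f (t + n) = f t"
  shows "f (t + c * n) = f t"
proof (induction c)
  case (Suc c)
  have "f (t + Suc c * n) = f (t + c * n + n)" by (simp add: algebra_simps)
  then show ?case using Suc assms by simp
qed simp

lemma periodic_mod:
  fixes f :: "nat \<Rightarrow> 'a"
  assumes "\<And>t. f (t + n) = f t"
  shows "f (t mod n) = f t"
  using periodic_mult[of f, OF assms, of "t mod n" "t div n"] by simp

text \<open>Exactly the values \<open>1, ..., p t\<close> are at most \<open>p t\<close>, each taken
  once. So a bijection onto \<open>{1..n}\<close> is recovered from the order it induces, which is
  how \<open>orbit_unique\<close> passes from equal comparisons to equal orbits.\<close>

lemma rank_of_bij:
  fixes p :: "nat \<Rightarrow> nat"
  assumes "bij_betw p {..<n} {1..n}" "t < n"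
  shows "p t = card {u. u < n \<and> p u \<le> p t}"
proof -
  have inj: "inj_on p {..<n}" and im: "p ` {..<n} = {1..n}"
    using assms(1) by (auto simp: bij_betw_def)
  have "p t \<in> {1..n}" using im assms(2) by blast
  have "p ` {u. u < n \<and> p u \<le> p t} = {1..p t}"
  proof safe
    fix u assume "u < n" "p u \<le> p t"
    then show "p u \<in> {1..p t}" using im by (metis atLeastAtMost_iff image_eqI lessThan_iff)
  next
    fix y assume "y \<in> {1..p t}"
    then have "y \<in> p ` {..<n}" using \<open>p t \<in> {1..n}\<close> unfolding im by auto
    then show "y \<in> p ` {u. u < n \<and> p u \<le> p t}" using \<open>y \<in> {1..p t}\<close> by auto
  qed
  then have "card {1..p t} = card {u. u < n \<and> p u \<le> p t}"
    by (metis (no_types, lifting) card_image inj inj_on_subset lessThan_iff mem_Collect_eq subsetI)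
  then show ?thesis by simp
qed

text \<open>Each index is sent to the number of indices with no larger key. This turns a key
  computed from a word into the values of an orbit.\<close>

lemma ex_rank_bij:
  fixes f :: "nat \<Rightarrow> nat"
  assumes "inj_on f {..<n}"
  obtains p where "bij_betw p {..<n} {1..n}"
    and "\<And>t u. t < n \<Longrightarrow> u < n \<Longrightarrow> p t < p u \<longleftrightarrow> f t < f u"
proof
  define p where "p t = card {u. u < n \<and> f u \<le> f t}" for t
  have mono: "p t < p u" if "t < n" "u < n" "f t < f u" for t u
    unfolding p_def
  proof (rule psubset_card_mono)
    show "{v. v < n \<and> f v \<le> f t} \<subset> {v. v < n \<and> f v \<le> f u}"
    proof
      show "{v. v < n \<and> f v \<le> f t} \<subseteq> {v. v < n \<and> f v \<le> f u}" using that by auto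
      show "{v. v < n \<and> f v \<le> f t} \<noteq> {v. v < n \<and> f v \<le> f u}"
        using that by (metis (mono_tags, lifting) le_refl linorder_not_le mem_Collect_eq)
    qed
  qed simp
  show iff: "p t < p u \<longleftrightarrow> f t < f u" if "t < n" "u < n" for t u
    using mono[of t u] mono[of u t] that assms
    by (metis inj_onD lessThan_iff linorder_neqE_nat order_less_asym order_less_irrefl)
  have "inj_on p {..<n}"
    using iff assms by (metis inj_on_def lessThan_iff linorder_neqE_nat order_less_irrefl)
  moreover have "p ` {..<n} \<subseteq> {1..n}"
  proof safe
    fix t assume "t < n"
    then have "{u. u < n \<and> f u \<le> f t} \<noteq> {}" by auto
    moreover have "card {u. u < n \<and> f u \<le> f t} \<le> card {..<n}" by (intro card_mono) auto
    ultimately show "p t \<in> {1..n}" unfolding p_def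
      by (simp add: Suc_le_eq card_gt_0_iff)
  qed
  ultimately show "bij_betw p {..<n} {1..n}"
    by (metis bij_betw_def card_atLeastAtMost card_image card_lessThan card_subset_eq diff_Suc_1
        finite_atLeastAtMost)
qed

lemma digit_less_iff:
  fixes a b x y c :: nat
  assumes "x < c" "y < c"
  shows "a * c + x < b * c + y \<longleftrightarrow> a < b \<or> a = b \<and> x < y"
proof -
  have "(a * c + x) div c = a" "(b * c + y) div c = b"
    using assms by auto
  then have "a * c + x < b * c + y \<Longrightarrow> a \<le> b"
    by (metis div_le_mono less_imp_le)
  moreover have "a * c + x < b * c + y" if "a < b"
  proof -
    have "(a + 1) * c \<le> b * c" using that by (intro mult_right_mono) auto
    then show ?thesis using assms by (simp add: algebra_simps)
  qed
  ultimately show ?thesis by (cases "a = b") auto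
qed

section \<open>Signed orbits and their words\<close>

locale signed_alphabet =
  fixes k :: nat and neg :: "nat \<Rightarrow> bool"
begin

text \<open>The first \<open>m\<close> letters from position \<open>t\<close> on are read as a base-\<open>k\<close> numeral in which every
  negative letter complements all later digits. Comparing these numbers is the lexicographic order
  twisted by the signs.\<close>

primrec sval :: "(nat \<Rightarrow> nat) \<Rightarrow> nat \<Rightarrow> nat \<Rightarrow> nat" where
  "sval w 0 t = 0"
| "sval w (Suc m) t = w t * k ^ m +
     (if neg (w t) then k ^ m - 1 - sval w m (Suc t) else sval w m (Suc t))"

definition negs :: "(nat \<Rightarrow> nat) \<Rightarrow> nat \<Rightarrow> nat" where
  "negs w t = (\<Sum>j<t. of_bool (neg (w j)))"

lemma negs_0 [simp]: "negs w 0 = 0"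
  by (simp add: negs_def)

lemma negs_Suc [simp]: "negs w (Suc t) = negs w t + of_bool (neg (w t))"
  by (simp add: negs_def)

lemma negs_periodic:
  assumes "\<And>t. w (t + d) = w t"
  shows "negs w (t + d) = negs w t + negs w d"
  by (induction t) (simp_all add: assms)

lemma sval_bound:
  assumes "\<And>t. w t < k"
  shows "sval w m t < k ^ m"
proof (induction m arbitrary: t)
  case (Suc m)
  have "k > 0" using assms[of 0] by simp
  then have "(if neg (w t) then k ^ m - 1 - sval w m (Suc t) else sval w m (Suc t)) < k ^ m"
    using Suc.IH[of "Suc t"] by simp
  moreover have "(w t + 1) * k ^ m \<le> k * k ^ m"
    using assms[of t] by (intro mult_right_mono) auto
  ultimately show ?case by (simp add: algebra_simps)
qed simp

text \<open>The tails stay below \<open>k ^ m\<close>, so the leading digit decides first; for equal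
  leading digits, complementing both tails reverses their comparison.\<close>

lemma sval_Suc_less_iff:
  assumes "\<And>t. w t < k"
  shows "sval w (Suc m) t < sval w (Suc m) u \<longleftrightarrow> w t < w u \<or> w t = w u \<and>
    (if neg (w t) then sval w m (Suc u) < sval w m (Suc t) else sval w m (Suc t) < sval w m (Suc u))"
proof -
  have b: "sval w m t < k ^ m" for t by (rule sval_bound[OF assms])
  have "(if neg (w t) then k ^ m - 1 - sval w m (Suc t) else sval w m (Suc t)) < k ^ m" for t
    using b[of "Suc t"] by auto
  then show ?thesis
    unfolding sval.simps
    using digit_less_iff[of _ "k ^ m" _ "w t" "w u"] b[of "Suc t"] b[of "Suc u"]
    by auto
qed

text \<open>Complementing is injective and equal leading letters carry equal signs, so the numeral
  loses no information about the letters read.\<close>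

lemma sval_eq_iff:
  assumes "\<And>t. w t < k"
  shows "sval w m t = sval w m u \<longleftrightarrow> (\<forall>j<m. w (t + j) = w (u + j))"
proof (induction m arbitrary: t u)
  case (Suc m)
  have "sval w (Suc m) t = sval w (Suc m) u \<longleftrightarrow>
      \<not> sval w (Suc m) t < sval w (Suc m) u \<and> \<not> sval w (Suc m) u < sval w (Suc m) t"
    by linarith
  also have "\<dots> \<longleftrightarrow> w t = w u \<and> sval w m (Suc t) = sval w m (Suc u)"
    unfolding sval_Suc_less_iff[OF assms]
    by (cases "neg (w t)"; cases "w t = w u") (simp_all, linarith+)
  also have "\<dots> \<longleftrightarrow> (\<forall>j<Suc m. w (t + j) = w (u + j))"
    unfolding Suc.IH by (auto simp: less_Suc_eq_0_disj)
  finally show ?case .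
qed simp

text \<open>The comparison is decided at the first differing letter, under the signs before it, and
  an additional letter at the end changes neither.\<close>

lemma sval_less_mono:
  assumes "\<And>t. w t < k" and "sval w m t < sval w m u"
  shows "sval w (Suc m) t < sval w (Suc m) u"
  using assms(2)
proof (induction m arbitrary: t u)
  case (Suc m)
  show ?case
    using Suc.prems[unfolded sval_Suc_less_iff[OF assms(1)]]
      Suc.IH[of "Suc t" "Suc u"] Suc.IH[of "Suc u" "Suc t"]
    by (subst sval_Suc_less_iff[OF assms(1)]) (auto split: if_splits simp del: sval.simps)
qed simp

lemma sval_shift: "sval (\<lambda>t. w (t + c)) m t = sval w m (t + c)"
  by (induction m arbitrary: t) simp_all

text \<open>These are, up to rotation, the words of signed orbits. The parity condition is imposed
  on every proper period, not just the least one, so that it also applies to multiples of a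
  period.\<close>

definition admissible :: "nat \<Rightarrow> (nat \<Rightarrow> nat) \<Rightarrow> bool" where
  "admissible n w \<longleftrightarrow> (\<forall>t. w t < k) \<and> (\<forall>t. w (t + n) = w t) \<and>
     (\<forall>d. 0 < d \<and> d < n \<and> (\<forall>t. w (t + d) = w t) \<longrightarrow> odd (negs w d))"

text \<open>\<open>p t\<close> is the image of \<open>1\<close> under the \<open>t\<close>-th power of a cyclic permutation of \<open>[n]\<close>, and
  \<open>w t\<close> is the index of the segment containing \<open>p t\<close>.\<close>

definition signed_orbit :: "nat \<Rightarrow> (nat \<Rightarrow> nat) \<Rightarrow> (nat \<Rightarrow> nat) \<Rightarrow> bool" where
  "signed_orbit n p w \<longleftrightarrow> n > 0 \<and> p 0 = 1 \<and> (\<forall>t. p (t + n) = p t) \<and> bij_betw p {..<n} {1..n} \<and>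
     (\<forall>t. w t < k) \<and> (\<forall>t. w (t + n) = w t) \<and>
     (\<forall>t u. p t < p u \<longrightarrow> w t \<le> w u) \<and>
     (\<forall>t u. w t = w u \<and> p t < p u \<longrightarrow>
        (if neg (w t) then p (Suc u) < p (Suc t) else p (Suc t) < p (Suc u)))"

section \<open>What an orbit and its word determine about each other\<close>

context
  fixes n p w
  assumes so: "signed_orbit n p w"
begin

lemma orbit_simps:
  shows "p 0 = 1" "p (t + n) = p t" "bij_betw p {..<n} {1..n}" "w t < k" "w (t + n) = w t"
    "n > 0" "p t \<ge> 1"
proof -
  show p0: "p 0 = 1" and per: "p (t + n) = p t" for t using so by (auto simp: signed_orbit_def)
  show b: "bij_betw p {..<n} {1..n}" and "w t < k" "w (t + n) = w t"
    using so by (auto simp: signed_orbit_def)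
  show n: "n > 0" using so by (auto simp: signed_orbit_def)
  have "p (t mod n) \<in> {1..n}" using b n by (meson bij_betwE lessThan_iff mod_less_divisor)
  then show "p t \<ge> 1" using periodic_mod[of p n, OF per] by simp
qed

lemma orbit_eq_iff: "p t = p u \<longleftrightarrow> t mod n = u mod n"
proof -
  have "p (t mod n) = p (u mod n) \<longleftrightarrow> t mod n = u mod n"
    using orbit_simps(3,6) by (auto simp: bij_betw_def inj_on_def)
  then show ?thesis using periodic_mod[of p n, OF orbit_simps(2)] by simp
qed

lemma orbit_eq_imp:
  assumes "p t = p u"
  shows "w (t + j) = w (u + j)" "p (t + j) = p (u + j)"
proof -
  have "(t + j) mod n = (u + j) mod n"
    using assms unfolding orbit_eq_iff by (metis mod_add_left_eq)
  then show "w (t + j) = w (u + j)" "p (t + j) = p (u + j)"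
    using periodic_mod[of w n, OF orbit_simps(5)] orbit_eq_iff by metis+
qed

lemma orbit_step:
  assumes "w t = w u" "p t \<noteq> p u"
  shows "p (Suc t) \<noteq> p (Suc u)"
    and "p (Suc t) < p (Suc u) \<longleftrightarrow> (p t < p u \<longleftrightarrow> \<not> neg (w t))"
proof -
  have "w t = w u \<Longrightarrow> p t < p u \<Longrightarrow>
      if neg (w t) then p (Suc u) < p (Suc t) else p (Suc t) < p (Suc u)" for t u
    using so by (auto simp: signed_orbit_def)
  with this[of t u] this[of u t] assms linorder_neqE_nat[OF assms(2)]
  show "p (Suc t) \<noteq> p (Suc u)" "p (Suc t) < p (Suc u) \<longleftrightarrow> (p t < p u \<longleftrightarrow> \<not> neg (w t))"
    by (metis order_less_asym order_less_irrefl)+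
qed

text \<open>Different first letters decide because letters increase weakly with the values. Equal
  first letters pass the question to the successors, where the orbit and the numeral reverse under
  the same condition. The fact \<open>eq\<close> rules out coinciding points.\<close>

lemma orbit_less_of_sval_less: "sval w m t < sval w m u \<Longrightarrow> p t < p u"
proof (induction m arbitrary: t u)
  case (Suc m)
  have eq: "w t = w u \<and> p (Suc t) = p (Suc u)" if "p t = p u"
    using orbit_eq_imp[OF that, of 0] orbit_eq_imp[OF that, of 1] by simp
  consider "w t < w u" | "w t = w u" "neg (w t)" "sval w m (Suc u) < sval w m (Suc t)"
    | "w t = w u" "\<not> neg (w t)" "sval w m (Suc t) < sval w m (Suc u)"
    using Suc.prems[unfolded sval_Suc_less_iff[of w, OF orbit_simps(4)]] by (auto split: if_splits)
  then show ?case
  proof cases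
    case 1
    moreover have "p u < p t \<Longrightarrow> w u \<le> w t" using so by (auto simp: signed_orbit_def)
    ultimately show ?thesis using eq by fastforce
  next
    case 2
    then show ?thesis using Suc.IH[OF 2(3)] eq orbit_step[OF 2(1)] by fastforce
  next
    case 3
    then show ?thesis using Suc.IH[OF 3(3)] eq orbit_step[OF 3(1)] by fastforce
  qed
qed simp

text \<open>Every common negative letter flips the order once. The sum
  \<open>negs w (t + m) + negs w t\<close> has the parity of the number of flips between
  \<open>t\<close> and \<open>t + m\<close>, without a subtraction.\<close>

lemma orbit_less_parity:
  assumes "\<And>j. j < m \<Longrightarrow> w (t + j) = w (u + j)" "p t \<noteq> p u"
  shows "p (t + m) \<noteq> p (u + m) \<and>
    (p (t + m) < p (u + m) \<longleftrightarrow> (p t < p u \<longleftrightarrow> even (negs w (t + m) + negs w t)))"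
  using assms(1)
proof (induction m)
  case 0
  then show ?case using assms(2) by simp
next
  case (Suc m)
  then have IH: "p (t + m) \<noteq> p (u + m)"
    "p (t + m) < p (u + m) \<longleftrightarrow> (p t < p u \<longleftrightarrow> even (negs w (t + m) + negs w t))"
    by simp_all
  show ?case
    using orbit_step[OF Suc.prems[of m] IH(1)] IH(2) by auto
qed

lemma orbit_admissible: "admissible n w"
  unfolding admissible_def
proof (intro conjI allI impI)
  fix d assume d: "0 < d \<and> d < n \<and> (\<forall>t. w (t + d) = w t)"
  show "odd (negs w d)"
  proof
    assume ev: "even (negs w d)"
    have "p d \<noteq> p 0" using d orbit_eq_iff by simp
    then have start: "p 0 < p d" using orbit_simps(1) orbit_simps(7)[of d] by simp
    \<comment> \<open>Shifting by an even period preserves the order, so one rise propagates along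
      all multiples of \<open>d\<close>.\<close>
    have step: "p (j * d) < p (j * d + d)" for j
    proof (induction j)
      case (Suc j)
      have "w (j * d + i) = w (j * d + d + i)" for i
        using d by (metis add.assoc add.commute)
      then have "p (j * d + d) < p (j * d + d + d)"
        using orbit_less_parity[of d "j * d" "j * d + d"] Suc d ev
          negs_periodic[of w d "j * d"] by simp
      then show ?case by (simp add: add.commute)
    qed (use start in simp)
    have "p 0 < p (Suc j * d)" for j
    proof (induction j)
      case (Suc j)
      then show ?case using step[of "Suc j"] by (simp add: algebra_simps)
    qed (use start in simp)
    \<comment> \<open>After \<open>n\<close> shifts by \<open>d\<close> the orbit is back at its
      start, although it has only risen.\<close>
    from this[of "n - 1"] have "p 0 < p (n * d)" using orbit_simps(6) by simp
    moreover have "p (n * d) = p 0" unfolding orbit_eq_iff by simp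
    ultimately show False by simp
  qed
qed (use orbit_simps in auto)

text \<open>As the orbit starts at \<open>1\<close>, its word is the least among its rotations; this picks the same
  representative of a necklace for all orbits.\<close>

lemma orbit_sval_min: "sval w n 0 \<le> sval w n t"
  using orbit_less_of_sval_less[of n t 0] orbit_simps(1) orbit_simps(7)[of t] by fastforce

text \<open>After \<open>n - t\<close> steps the first point has returned to \<open>1\<close>, the
  least value, so the order there is known; \<open>orbit_less_parity\<close> carries it back to
  \<open>t\<close>. Hence even ties are resolved by the word alone.\<close>

lemma orbit_tie:
  assumes "t < n" "u < n" "t \<noteq> u" "sval w n t = sval w n u"
  shows "p t < p u \<longleftrightarrow> even (negs w n + negs w t)"
proof -
  have eq: "w (t + j) = w (u + j)" if "j < n" for j
    using assms(4) that sval_eq_iff[of w, OF orbit_simps(4)] by blast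
  have "p t \<noteq> p u" using assms(1-3) orbit_eq_iff by simp
  then have "p (t + (n - t)) \<noteq> p (u + (n - t)) \<and> (p (t + (n - t)) < p (u + (n - t)) \<longleftrightarrow>
      (p t < p u \<longleftrightarrow> even (negs w (t + (n - t)) + negs w t)))"
    using eq by (intro orbit_less_parity) auto
  moreover have "p (t + (n - t)) = 1"
    using assms(1) orbit_simps(1) orbit_simps(2)[of 0] by simp
  ultimately show ?thesis
    using orbit_simps(7)[of "u + (n - t)"] assms(1) by auto
qed

end

section \<open>Uniqueness and existence of the orbit of a word\<close>

text \<open>Both orbits order the times \<open>t < n\<close> alike, by \<open>sval\<close> and, for
  equal values, by the parity in \<open>orbit_tie\<close>. Equal orders give equal ranks, hence
  equal values.\<close>

lemma orbit_unique:
  assumes "signed_orbit n p w" "signed_orbit n p' w"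
  shows "p = p'"
proof
  fix t
  have less: "p t < p u \<longleftrightarrow> p' t < p' u" if "t < n" "u < n" for t u
  proof -
    consider "t = u" | "sval w n t < sval w n u" | "sval w n u < sval w n t"
      | "t \<noteq> u" "sval w n t = sval w n u" by linarith
    then show ?thesis
    proof cases
      case 2
      then show ?thesis using orbit_less_of_sval_less assms by blast
    next
      case 3
      then show ?thesis using orbit_less_of_sval_less assms order_less_asym by blast
    next
      case 4
      then show ?thesis
        using orbit_tie[OF assms(1) that] orbit_tie[OF assms(2) that] by blast
    qed simp
  qed
  have eq: "p t = p' t" if "t < n" for t
  proof -
    have "p u \<le> p t \<longleftrightarrow> p' u \<le> p' t" if "u < n" for u
      using less[OF \<open>t < n\<close> that] linorder_not_less by blast
    then have "{u. u < n \<and> p u \<le> p t} = {u. u < n \<and> p' u \<le> p' t}" by blast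
    then have "card {u. u < n \<and> p u \<le> p t} = card {u. u < n \<and> p' u \<le> p' t}" by (rule arg_cong)
    then show ?thesis
      unfolding rank_of_bij[OF orbit_simps(3)[OF assms(1)] that, symmetric]
        rank_of_bij[OF orbit_simps(3)[OF assms(2)] that, symmetric] .
  qed
  show "p t = p' t"
    using eq[of "t mod n"] orbit_simps(6)[OF assms(1)]
      periodic_mod[of p n, OF orbit_simps(2)[OF assms(1)]]
      periodic_mod[of p' n, OF orbit_simps(2)[OF assms(2)]] by simp
qed

text \<open>Minimality of both words closes the chain \<open>sval w n 0 <= sval w n c = sval w' n 0
  <= sval w' n c' = sval w n 0\<close>, so shifting by \<open>c\<close> fixes the word.\<close>

lemma orbit_shift_eq:
  assumes "signed_orbit n p w" "signed_orbit n p' w'"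
    and "w' = (\<lambda>t. w (t + c))" "w = (\<lambda>t. w' (t + c'))"
  shows "w = w'"
proof
  fix t
  have "sval w n 0 \<le> sval w n c" "sval w' n 0 \<le> sval w' n c'"
    using orbit_sval_min assms(1,2) by blast+
  moreover have "sval w' n 0 = sval w n c" "sval w n 0 = sval w' n c'"
    using sval_shift[of w c n 0] sval_shift[of w' c' n 0]
    unfolding assms(3)[symmetric] assms(4)[symmetric] by simp_all
  ultimately have "sval w n 0 = sval w n c" by simp
  then have "w (t mod n) = w (c + t mod n)"
    using sval_eq_iff[of w, OF orbit_simps(4)[OF assms(1)]] orbit_simps(6)[OF assms(1)] by simp
  moreover have "w' (t mod n) = w (c + t mod n)" unfolding assms(3) by (simp add: add.commute)
  ultimately show "w t = w' t"
    using periodic_mod[of w n, OF orbit_simps(5)[OF assms(1)]]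
      periodic_mod[of w' n, OF orbit_simps(5)[OF assms(2)]] by simp
qed

text \<open>A period \<open>c\<close> with \<open>2 * c < n\<close> would make \<open>2 * c\<close>
  a proper period with an even count of negative letters. This excludes both
  \<open>d < n - d\<close> and \<open>n - d < d\<close>, as \<open>n - d\<close> is a period as
  well.\<close>

lemma admissible_period:
  assumes "admissible n w" "0 < d" "d < n" "\<And>t. w (t + d) = w t"
  shows "n = 2 * d"
proof -
  have odd: "odd (negs w c)" if "0 < c" "c < n" "\<And>t. w (t + c) = w t" for c
    using assms(1) that by (auto simp: admissible_def)
  have small: "\<not> 2 * c < n" if "0 < c" "\<And>t. w (t + c) = w t" for c
  proof
    assume "2 * c < n"
    moreover have "w (t + 2 * c) = w t" for t
      using that(2)[of "t + c"] that(2)[of t] by (simp add: mult_2 add.assoc)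
    ultimately have "odd (negs w (2 * c))" using odd[of "2 * c"] that(1) by simp
    then show False using negs_periodic[of w c c] that(2) by (simp add: mult_2)
  qed
  have "w (t + (n - d)) = w t" for t
    using assms(3) assms(4)[of "t + (n - d)"] assms(1) by (simp add: admissible_def)
  from small[of "n - d", OF _ this] small[OF assms(2,4)] assms(3) show ?thesis by simp
qed

text \<open>Agreement over \<open>n\<close> letters is agreement forever, so the distance of the two
  positions is a proper period. It is therefore odd and equal to half of \<open>n\<close>, which
  makes the count over \<open>n\<close> letters even.\<close>

lemma admissible_tie:
  assumes "admissible n w" "t < n" "u < n" "t \<noteq> u" "sval w n t = sval w n u"
  shows "odd (negs w t + negs w u)" "even (negs w n)" "sval w n (Suc t) = sval w n (Suc u)"
proof -
  have bd: "\<And>t. w t < k" and per: "\<And>t. w (t + n) = w t"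
    and odd: "\<And>d. 0 < d \<Longrightarrow> d < n \<Longrightarrow> (\<And>t. w (t + d) = w t) \<Longrightarrow> odd (negs w d)"
    using assms(1) by (auto simp: admissible_def)
  have eq: "w (t + j) = w (u + j)" for j
  proof -
    have "w (t + j mod n) = w (u + j mod n)"
      using assms(2,5) sval_eq_iff[of w, OF bd] by simp
    moreover have "w (v + j mod n) = w (v + j)" for v
      using periodic_mod[of "\<lambda>j. w (v + j)" n] per by (metis add.assoc)
    ultimately show ?thesis by simp
  qed
  show "sval w n (Suc t) = sval w n (Suc u)"
    unfolding sval_eq_iff[of w, OF bd] using eq by (metis add_Suc_right add_Suc)
  have main: "odd (negs w t + negs w u) \<and> even (negs w n)"
    if "t < u" "u < n" and eq: "\<And>j. w (t + j) = w (u + j)" for t u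
  proof -
    define d where "d = u - t"
    have d: "0 < d" "d < n" "u = t + d" using that by (auto simp: d_def)
    obtain m where m: "n = Suc m" using d by (cases n) auto
    have pd: "w (s + d) = w s" for s
    proof -
      \<comment> \<open>Adding \<open>t * n = t + t * m\<close> moves \<open>s\<close> to a position
        past \<open>t\<close>, where the agreement applies without subtracting.\<close>
      have "w s = w (s + t * n)" by (rule periodic_mult[of w, OF per, symmetric])
      also have "\<dots> = w (t + (s + t * m))" by (simp add: m algebra_simps)
      also have "\<dots> = w (u + (s + t * m))" by (rule eq)
      also have "\<dots> = w (s + d + t * n)" by (simp add: m d algebra_simps)
      also have "\<dots> = w (s + d)" by (rule periodic_mult[of w, OF per])
      finally show ?thesis by simp
    qed
    have "odd (negs w d)" using odd d pd by blast
    moreover have "negs w u = negs w t + negs w d" using negs_periodic[of w d] pd d by simp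
    moreover have "negs w n = negs w d + negs w d"
      using admissible_period[OF assms(1) d(1,2) pd] negs_periodic[of w d d] pd by (simp add: mult_2)
    ultimately show ?thesis by simp
  qed
  from main[of t u] main[of u t] eq assms(2-4)
  show "odd (negs w t + negs w u)" "even (negs w n)"
    by (metis add.commute linorder_neqE_nat)+
qed

text \<open>The positions \<open>t\<close> are ranked by the value of the word starting at \<open>t\<close>, ties being broken by
  the parity of the number of negative letters before \<open>t\<close>: this parity changes along a step exactly
  when the step reverses the order.\<close>

lemma admissible_ex_orbit:
  assumes "admissible n w" "n > 0"
  obtains p c where "signed_orbit n p (\<lambda>t. w (t + c))"
proof -
  have bd: "\<And>t. w t < k" and per: "\<And>t. w (t + n) = w t"
    using assms(1) by (auto simp: admissible_def)
  define f where "f t = 2 * sval w n t + negs w t mod 2" for t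
  have f_less: "f t < f u \<longleftrightarrow> sval w n t < sval w n u \<or>
      sval w n t = sval w n u \<and> even (negs w t) \<and> odd (negs w u)" for t u
    unfolding f_def even_iff_mod_2_eq_zero odd_iff_mod_2_eq_one by linarith
  have "inj_on f {..<n}"
  proof (rule inj_onI, rule ccontr)
    fix t u assume a: "t \<in> {..<n}" "u \<in> {..<n}" "f t = f u" "t \<noteq> u"
    then have "sval w n t = sval w n u"
      using f_less[of t u] f_less[of u t] unfolding f_def by linarith
    moreover from this a(3) have "negs w t mod 2 = negs w u mod 2" by (simp add: f_def)
    ultimately show False using admissible_tie(1)[OF assms(1), of t u] a by (auto simp: mod2_eq_if split: if_splits)
  qed
  then obtain q where bij: "bij_betw q {..<n} {1..n}"
    and q_less: "\<And>t u. t < n \<Longrightarrow> u < n \<Longrightarrow> q t < q u \<longleftrightarrow> f t < f u"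
    by (rule ex_rank_bij) blast
  have sval_mod: "sval w n (t mod n) = sval w n t" for t
  proof (rule periodic_mod)
    show "sval w n (t + n) = sval w n t" for t
      using sval_shift[of w n n t] per by simp
  qed
  obtain m where m: "n = Suc m" using assms(2) by (cases n) auto
  have le: "w t \<le> w u" if "f t < f u" for t u
  proof -
    have "sval w (Suc m) t < sval w (Suc m) u \<or> sval w (Suc m) t = sval w (Suc m) u"
      using that unfolding f_less m by blast
    then show ?thesis
      unfolding sval_Suc_less_iff[of w, OF bd] sval_eq_iff[of w, OF bd] by fastforce
  qed
  have step: "if neg (w t) then f (Suc u mod n) < f (Suc t mod n) else f (Suc t mod n) < f (Suc u mod n)"
    if "t < n" "u < n" "w t = w u" "f t < f u" for t u
  proof (cases "sval w n t = sval w n u")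
    case False
    then have "sval w (Suc m) t < sval w (Suc m) u" using that(4) f_less m by auto
    then have "if neg (w t) then sval w m (Suc u) < sval w m (Suc t)
        else sval w m (Suc t) < sval w m (Suc u)"
      unfolding sval_Suc_less_iff[of w, OF bd] using that(3) by simp
    \<comment> \<open>Removing the first letter leaves a comparison over \<open>n - 1\<close>
      letters, while \<open>f\<close> needs one over \<open>n\<close>.\<close>
    then have "if neg (w t) then sval w n (Suc u) < sval w n (Suc t)
        else sval w n (Suc t) < sval w n (Suc u)"
      unfolding m using sval_less_mono[of w, OF bd] by (simp del: sval.simps split: if_splits)
    then show ?thesis unfolding f_less sval_mod by (simp split: if_splits)
  next
    case True
    have "t \<noteq> u" using that(4) by auto
    note tie = admissible_tie[OF assms(1) that(1,2) \<open>t \<noteq> u\<close> True]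
    \<comment> \<open>Reduction modulo \<open>n\<close> matters only when \<open>Suc v = n\<close>
      wraps to \<open>0\<close>; the parity survives because \<open>negs w n\<close> is
      even.\<close>
    have par: "even (negs w (Suc v mod n)) \<longleftrightarrow> even (negs w (Suc v))" if "v < n" for v
      using that tie(2) by (cases "Suc v = n") auto
    have "even (negs w t)" "odd (negs w u)" using that(4) True by (auto simp: f_less)
    then show ?thesis
      unfolding f_less sval_mod par[OF that(1)] par[OF that(2)] tie(3) using that(3) by simp
  qed
  \<comment> \<open>The rotation \<open>c\<close> is the time of rank \<open>1\<close>, so that the
    orbit starts at \<open>1\<close>.\<close>
  have "1 \<in> q ` {..<n}" using bij assms(2) by (auto simp: bij_betw_def)
  then obtain c where c: "c < n" "q c = 1" by auto
  define p where "p t = q ((t + c) mod n)" for t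
  have n0: "x mod n < n" for x using assms(2) by simp
  have w_mod: "w (t mod n) = w t" for t by (rule periodic_mod[of w, OF per])
  have "bij_betw (\<lambda>t. (t + c) mod n) {..<n} {..<n}"
  proof -
    have "inj_on (\<lambda>t. (t + c) mod n) {..<n}"
    proof (rule inj_onI)
      fix x y assume "x \<in> {..<n}" "y \<in> {..<n}" "(x + c) mod n = (y + c) mod n"
      then show "x = y" using c(1) by (auto simp: mod_if split: if_splits)
    qed
    then show ?thesis
      by (metis (no_types, lifting) bij_betw_def endo_inj_surj finite_lessThan image_subsetI lessThan_iff n0)
  qed
  then have "bij_betw p {..<n} {1..n}"
    unfolding p_def using bij_betw_trans[OF _ bij] by (simp add: comp_def)
  moreover have "p t < p u \<Longrightarrow> w (t + c) \<le> w (u + c)" for t u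
    unfolding p_def q_less[OF n0 n0] using le w_mod by metis
  moreover have "if neg (w (t + c)) then p (Suc u) < p (Suc t) else p (Suc t) < p (Suc u)"
    if "w (t + c) = w (u + c)" "p t < p u" for t u
  proof -
    have "f ((t + c) mod n) < f ((u + c) mod n)"
      using that(2) unfolding p_def q_less[OF n0 n0] .
    from step[OF n0 n0 _ this] that(1) show ?thesis
      unfolding p_def q_less[OF n0 n0] w_mod mod_Suc_eq by simp
  qed
  moreover have "p 0 = 1" using c by (simp add: p_def)
  moreover have "p (t + n) = p t" "w (t + n + c) = w (t + c)" for t
    using per[of "t + c"] by (simp_all add: p_def add.assoc add.commute[of n c]) (simp flip: add.assoc)
  ultimately have "signed_orbit n p (\<lambda>t. w (t + c))"
    unfolding signed_orbit_def using bd assms(2) by blast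
  then show ?thesis by (rule that)
qed

end

section \<open>Admissible words and necklaces\<close>

definition cyc :: "'a list \<Rightarrow> nat \<Rightarrow> 'a" where
  "cyc s t = s ! (t mod length s)"

lemma cyc_periodic: "cyc s (t + length s) = cyc s t"
  by (simp add: cyc_def)

lemma cyc_rotate: "s \<noteq> [] \<Longrightarrow> cyc (rotate j s) t = cyc s (t + j)"
  by (simp add: cyc_def nth_rotate mod_add_right_eq add.commute)

lemma cyc_inject: "length s = length s' \<Longrightarrow> cyc s = cyc s' \<Longrightarrow> s = s'"
  by (rule nth_equalityI) (simp, metis cyc_def mod_less)

lemma cyc_map_upt:
  assumes "\<And>t. w (t + n) = w t" "n > 0"
  shows "cyc (map w [0..<n]) = w"
  using assms periodic_mod[of w n] by (auto simp: cyc_def fun_eq_iff)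

lemma cyc_concat_replicate:
  assumes "r > 0" "q \<noteq> []"
  shows "cyc (concat (replicate r q)) = cyc q"
proof
  fix t
  have nth: "i < r * length q \<Longrightarrow> concat (replicate r q) ! i = q ! (i mod length q)" for i
    by (induction r arbitrary: i) (auto simp: nth_append le_mod_geq)
  have len: "length (concat (replicate r q)) = r * length q"
    by (induction r) auto
  have "t mod (r * length q) mod length q = t mod length q"
    by (simp add: mod_mod_cancel)
  then show "cyc (concat (replicate r q)) t = cyc q t"
    using assms nth[of "t mod (r * length q)"] by (simp add: cyc_def len del: length_concat)
qed

text \<open>Here \<open>d\<close> need not divide the length. The period makes the prefix of length
  \<open>d\<close> commute with the remaining suffix, and commuting words are powers of a common
  word.\<close>

lemma not_primitive_of_period:
  assumes "0 < d" "d < length s" "\<And>t. cyc s (t + d) = cyc s t"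
  shows "\<not> primitive s"
proof -
  have "s \<noteq> []" using assms by auto
  then have "cyc (rotate d s) = cyc s" using assms(3) by (auto simp: cyc_rotate)
  then have "rotate d s = s" by (intro cyc_inject) auto
  then have "take d s @ drop d s = drop d s @ take d s"
    using assms(2) by (simp add: rotate_drop_take)
  then obtain a b z where z: "concat (replicate a z) = take d s" "concat (replicate b z) = drop d s"
    using comm_append_are_replicate by blast
  then have "s = concat (replicate (a + b) z)"
    by (simp add: replicate_add)
  moreover have "a > 0" using z(1) assms by (intro gr0I) auto
  moreover have "b > 0" using z(2) assms by (intro gr0I) auto
  ultimately have "s = concat (replicate (a + b) z)" "a + b > 1" by simp_all
  then show ?thesis unfolding primitive_def by blast
qed

lemma length_filter_eq_sum: "length (filter P q) = (\<Sum>j<length q. of_bool (P (q ! j)))"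
  by (induction q rule: rev_induct) (auto simp: nth_append)

context signed_alphabet
begin

lemma negs_cyc_length: "negs (cyc q) (length q) = length (filter neg q)"
  unfolding negs_def length_filter_eq_sum by (rule sum.cong) (auto simp: cyc_def)

text \<open>A proper power is periodic with the length of its root, so
  \<open>admissible_period\<close> leaves only squares; a nonprimitive \<open>q\<close> would make
  \<open>s\<close> at least a fourth power.\<close>

lemma admissible_cyc_iff:
  assumes "s \<in> words k n" "n > 0"
  shows "admissible n (cyc s) \<longleftrightarrow>
    primitive s \<or> (\<exists>q. s = q @ q \<and> primitive q \<and> odd (length (filter neg q)))"
proof -
  have len: "length s = n" and s: "set s \<subseteq> {0..<k}" using assms(1) by (auto simp: words_def)
  have bd: "cyc s t < k" for t
  proof -
    have "cyc s t \<in> set s" unfolding cyc_def using assms(2) len by (intro nth_mem) auto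
    then show ?thesis using s by auto
  qed
  have per: "cyc s (t + n) = cyc s t" for t using cyc_periodic[of s] len by simp
  have power: "n = 2 * length z" "cyc s = cyc z" if "admissible n (cyc s)" "r > 1" "s = concat (replicate r z)" for r z
  proof -
    have "n = r * length z" using len that(3) by (simp add: length_concat sum_list_replicate)
    then have z: "z \<noteq> []" "length z < n" "length z > 0" using that(2) assms(2) by auto
    then show eq: "cyc s = cyc z" using that(2,3) cyc_concat_replicate[of r z] by simp
    show "n = 2 * length z"
      using admissible_period[OF that(1) z(3,2)] cyc_periodic[of z] eq by simp
  qed
  show ?thesis
  proof
    assume adm: "admissible n (cyc s)"
    show "primitive s \<or> (\<exists>q. s = q @ q \<and> primitive q \<and> odd (length (filter neg q)))"
    proof (cases "primitive s")
      case False
      then obtain q r where r: "r > 1" "s = concat (replicate r q)" by (auto simp: primitive_def)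
      have h: "n = 2 * length q" "cyc s = cyc q" using power[OF adm r] by auto
      have "n = r * length q" using len r(2) by (simp add: length_concat sum_list_replicate)
      then have "r = 2" using h(1) assms(2) by simp
      then have sq: "s = q @ q" using r(2) by (simp add: numeral_2_eq_2)
      have "odd (negs (cyc s) (length q))"
        using adm h assms(2) cyc_periodic[of q] by (auto simp: admissible_def)
      then have "odd (length (filter neg q))" using h(2) negs_cyc_length by simp
      moreover have "primitive q"
      proof (rule ccontr)
        assume "\<not> primitive q"
        then obtain z j where j: "j > 1" "q = concat (replicate j z)" by (auto simp: primitive_def)
        have "s = concat (replicate (j + j) z)" unfolding sq j(2) by (simp add: replicate_add)
        then have "n = 2 * length z" using power(1)[OF adm, of "j + j" z] j(1) by simp
        moreover have "length q = j * length z" using j(2) by (simp add: length_concat sum_list_replicate)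
        ultimately show False using h(1) j(1) assms(2) by simp
      qed
      ultimately show ?thesis using sq by blast
    qed simp
  next
    assume "primitive s \<or> (\<exists>q. s = q @ q \<and> primitive q \<and> odd (length (filter neg q)))"
    then have "odd (negs (cyc s) d)" if "0 < d" "d < n" "\<And>t. cyc s (t + d) = cyc s t" for d
    proof
      assume "primitive s"
      then show ?thesis using not_primitive_of_period[of d s] that len by blast
    next
      assume "\<exists>q. s = q @ q \<and> primitive q \<and> odd (length (filter neg q))"
      then obtain q where q: "s = q @ q" "primitive q" "odd (length (filter neg q))" by blast
      have n: "n = 2 * length q" using q(1) len by simp
      have "q \<noteq> []" using n assms(2) by auto
      then have eq: "cyc s = cyc q"
        using cyc_concat_replicate[of 2 q] q(1) by (simp add: numeral_2_eq_2)
      \<comment> \<open>Otherwise \<open>d mod length q\<close> is a nonzero proper period of the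
        primitive word \<open>q\<close>.\<close>
      have "d = length q"
      proof (rule ccontr)
        assume ne: "d \<noteq> length q"
        have "cyc q (t + d mod length q) = cyc q t" for t
          using that(3)[of t] unfolding eq by (simp add: cyc_def mod_add_right_eq)
        moreover have "0 < d mod length q"
          using ne that(1,2) n by (cases "d < length q") (auto simp: mod_if)
        ultimately show False
          using not_primitive_of_period[of "d mod length q" q] q(2) \<open>q \<noteq> []\<close> by simp
      qed
      then show ?thesis using q(3) eq negs_cyc_length by simp
    qed
    then show "admissible n (cyc s)" unfolding admissible_def using bd per by blast
  qed
qed

end

section \<open>Rotation classes and the count of primitive and square necklaces\<close>

lemma rotate_append_self: "rotate j (q @ q) = rotate j q @ rotate j q"
proof (induction j)
  case (Suc j)
  have "rotate1 (z @ z) = rotate1 z @ rotate1 z" for z :: "'a list" by (cases z) auto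
  then show ?case using Suc by simp
qed simp

lemma rotate_inverse: "\<exists>j'. s = rotate j' (rotate j s)"
proof (intro exI)
  \<comment> \<open>The two rotations add up to \<open>length s * j\<close>, a multiple of the
    length.\<close>
  show "s = rotate ((length s - 1) * j) (rotate j s)"
  proof (cases "s = []")
    case False
    then have "(length s - 1) * j + j = length s * j" by (cases "length s") auto
    then show ?thesis by (simp add: rotate_rotate rotate_id)
  qed simp
qed

lemma necklace_eq_iff: "necklace s = necklace s' \<longleftrightarrow> (\<exists>j. s' = rotate j s)"
proof
  have "s' = rotate 0 s'" by simp
  then have "s' \<in> necklace s'" unfolding necklace_def by blast
  then show "necklace s = necklace s' \<Longrightarrow> \<exists>j. s' = rotate j s" unfolding necklace_def by auto
next
  have sub: "necklace (rotate j s) \<subseteq> necklace s" for j s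
    unfolding necklace_def by (auto simp: rotate_rotate)
  assume "\<exists>j. s' = rotate j s"
  then obtain j where j: "s' = rotate j s" by blast
  obtain j' where "s = rotate j' s'" using rotate_inverse j by blast
  then show "necklace s = necklace s'" using sub[of j s] sub[of j' s'] j by simp
qed

lemma necklace_append_self: "necklace (q @ q) = (\<lambda>s. s @ s) ` necklace q"
  unfolding necklace_def by (auto simp: rotate_append_self)

lemma finite_words: "finite (words k n)"
  using finite_lists_length_eq[of "{0..<k}" n] by (simp add: words_def conj_commute)

text \<open>Rotations of a square are squares, so the two kinds of necklaces are disjoint. Squaring
  is injective and commutes with rotation, so square necklaces correspond to necklaces of their
  roots, which have length \<open>n div 2\<close>.\<close>

lemma card_necklaces_with_squares:
  "card (necklace ` {s \<in> words k n. primitive s \<or> (\<exists>q. s = q @ q \<and> primitive q \<and> P q)}) =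
   card (necklace ` {s \<in> words k n. primitive s}) +
   (if even n then card (necklace ` {q \<in> words k (n div 2). primitive q \<and> P q}) else 0)"
proof -
  define Q where "Q = {q. q @ q \<in> words k n \<and> primitive q \<and> P q}"
  have Q: "Q = (if even n then {q \<in> words k (n div 2). primitive q \<and> P q} else {})"
    unfolding Q_def words_def by auto
  have fin: "finite Q" unfolding Q using finite_words[of k "n div 2"] by auto
  have inj: "inj (\<lambda>s :: nat list. s @ s)"
  proof (rule injI)
    fix x y :: "nat list" assume eq: "x @ x = y @ y"
    then have "length (x @ x) = length (y @ y)" by (rule arg_cong)
    then have "length x = length y" by simp
    then show "x = y" using eq by simp
  qed
  have "necklace ` {s \<in> words k n. primitive s \<or> (\<exists>q. s = q @ q \<and> primitive q \<and> P q)} =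
      necklace ` {s \<in> words k n. primitive s} \<union> necklace ` (\<lambda>s. s @ s) ` Q"
    unfolding Q_def by auto
  moreover have "necklace ` {s \<in> words k n. primitive s} \<inter> necklace ` (\<lambda>s. s @ s) ` Q = {}"
  proof -
    have False if "primitive s" "necklace (q @ q) = necklace s" for s q
    proof -
      obtain j where "s = rotate j (q @ q)" using \<open>necklace (q @ q) = necklace s\<close> necklace_eq_iff by blast
      then have "s = concat (replicate 2 (rotate j q))"
        by (simp add: rotate_append_self numeral_2_eq_2)
      then show False using \<open>primitive s\<close> unfolding primitive_def by (metis one_less_numeral_iff semiring_norm(76))
    qed
    then show ?thesis by blast
  qed
  moreover have "card (necklace ` (\<lambda>s. s @ s) ` Q) = card (necklace ` Q)"
  proof -
    have "necklace ` (\<lambda>s. s @ s) ` Q = image (\<lambda>s. s @ s) ` necklace ` Q"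
      by (simp add: image_image necklace_append_self)
    moreover have "inj_on (image (\<lambda>s :: nat list. s @ s)) (necklace ` Q)"
      using inj by (meson inj_image_eq_iff inj_onI)
    ultimately show ?thesis by (simp add: card_image)
  qed
  ultimately show ?thesis
    using fin finite_words[of k n] by (simp add: card_Un_disjoint Q)
qed

section \<open>Segmented cyclic permutations\<close>

definition label :: "nat \<Rightarrow> nat \<Rightarrow> nat \<Rightarrow> nat" where
  "label a b x = (if x \<le> a then 0 else if x \<le> b then 1 else 2)"

text \<open>The pair holds the inner breakpoints \<open>e 1\<close> and \<open>e 2\<close> of
  \<open>shape_perms\<close>. A function \<open>e\<close> is also free beyond the last index and
  could not be counted. Empty segments are allowed, so different pairs may cut the same
  permutation.\<close>

definition segmentations :: "nat \<Rightarrow> (nat \<Rightarrow> nat) \<Rightarrow> (nat \<times> nat) set" where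
  "segmentations n f = {(a, b). a \<le> b \<and> b \<le> n \<and> strict_mono_on {0<..a} f \<and>
     strict_mono_on {a<..b} f \<and> strict_antimono_on {b<..n} f}"

lemma perm_fun_bij:
  assumes "xs \<in> perms n"
  shows "bij_betw (perm_fun xs) {1..n} {1..n}"
proof -
  have perm: "length xs = n" "distinct xs" "set xs = {1..n}" using assms by (auto simp: perms_def)
  have "inj_on (perm_fun xs) {1..n}"
  proof (rule inj_onI)
    fix x y assume xy: "x \<in> {1..n}" "y \<in> {1..n}" "perm_fun xs x = perm_fun xs y"
    then have "x - 1 = y - 1"
      using perm(1) nth_eq_iff_index_eq[OF perm(2), of "x - 1" "y - 1"] by (auto simp: perm_fun_def)
    then show "x = y" using xy(1,2) by auto
  qed
  moreover have "perm_fun xs ` {1..n} \<subseteq> set xs"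
    using perm(1) by (auto simp: perm_fun_def intro!: nth_mem)
  ultimately show ?thesis by (simp add: bij_betw_def endo_inj_surj perm(3))
qed

text \<open>A repetition before time \<open>n\<close> would confine the orbit to fewer than
  \<open>n\<close> points. The value at time \<open>n\<close> is then an earlier one, and by
  injectivity of the permutation it can only be the first.\<close>

lemma cyclic_perm_orbit:
  assumes "xs \<in> cyclic_perms n" "n > 0"
  defines "p \<equiv> \<lambda>t. (perm_fun xs ^^ t) 1"
  shows "bij_betw p {..<n} {1..n}" "p (t + n) = p t"
proof -
  have orb: "range p = {1..n}"
    using assms(1) unfolding p_def cyclic_perms_def by (simp add: full_SetCompr_eq)
  have Suc: "p (Suc t) = perm_fun xs (p t)" for t by (simp add: p_def)
  have mem: "p t \<in> {1..n}" for t using orb by blast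
  have inj_f: "inj_on (perm_fun xs) {1..n}"
    using perm_fun_bij[of xs n] assms(1) by (simp add: cyclic_perms_def bij_betw_def)
  have no: False if "p i = p j" "i < j" "j < n" for i j
  proof -
    have "p t \<in> p ` {..<j}" for t
    proof (induction t)
      case 0
      then show ?case using that by auto
    next
      case (Suc t)
      then obtain s where s: "s < j" "p t = p s" by auto
      then have "p (Suc t) = p (Suc s)" by (simp add: \<open>\<And>t. p (Suc t) = perm_fun xs (p t)\<close>)
      moreover have "p (Suc s) \<in> p ` {..<j}"
      proof (cases "Suc s = j")
        case True
        then show ?thesis using that(1,2) by (metis imageI lessThan_iff)
      qed (use s(1) in auto)
      ultimately show ?case by simp
    qed
    then have "{1..n} \<subseteq> p ` {..<j}" unfolding orb[symmetric] by blast
    then have "n \<le> card (p ` {..<j})" using card_mono[of "p ` {..<j}" "{1..n}"] by simp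
    also have "\<dots> \<le> j" using card_image_le[of "{..<j}" p] by simp
    finally show False using that by simp
  qed
  have inj: "inj_on p {..<n}"
    by (rule inj_onI) (metis no lessThan_iff linorder_neqE_nat)
  moreover have im: "p ` {..<n} = {1..n}"
    using inj mem by (intro card_subset_eq) (auto simp: card_image)
  ultimately show "bij_betw p {..<n} {1..n}" by (simp add: bij_betw_def)
  have pn: "p n = p 0"
  proof -
    obtain s where s: "s < n" "p n = p s" using mem[of n] unfolding im[symmetric] by auto
    show ?thesis
    proof (cases s)
      case (Suc s')
      obtain m where m: "n = Suc m" using assms(2) by (cases n) auto
      have "p m = p s'" using s Suc m inj_onD[OF inj_f _ mem mem] \<open>\<And>t. p (Suc t) = perm_fun xs (p t)\<close> by metis
      then show ?thesis using inj_onD[OF inj, of m s'] s Suc m by auto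
    qed (use s in simp)
  qed
  show "p (t + n) = p t" by (induction t) (simp_all add: pn Suc)
qed

text \<open>The letters are the three segment indices of \<open>++-\<close>, and only the last
  segment reverses order.\<close>

interpretation signed_alphabet 3 "\<lambda>c. c = 2" .

lemma segmentation_orbit:
  assumes "xs \<in> cyclic_perms n" "n > 0" "(a, b) \<in> segmentations n (perm_fun xs)"
  defines "p \<equiv> \<lambda>t. (perm_fun xs ^^ t) 1"
  shows "signed_orbit n p (\<lambda>t. label a b (p t))"
proof -
  have per: "p (t + n) = p t" for t
    unfolding p_def by (rule cyclic_perm_orbit(2)[OF assms(1,2)])
  have bij: "bij_betw p {..<n} {1..n}"
    unfolding p_def by (rule cyclic_perm_orbit(1)[OF assms(1,2)])
  have mem: "0 < p t \<and> p t \<le> n" for t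
  proof -
    have "p (t mod n) \<in> {1..n}" using bij assms(2) by (meson bij_betwE lessThan_iff mod_less_divisor)
    then show ?thesis using periodic_mod[of p n, OF per] by simp
  qed
  have seg: "a \<le> b" "b \<le> n" "strict_mono_on {0<..a} (perm_fun xs)"
    "strict_mono_on {a<..b} (perm_fun xs)" "strict_antimono_on {b<..n} (perm_fun xs)"
    using assms(3) by (auto simp: segmentations_def)
  have Suc: "p (Suc t) = perm_fun xs (p t)" for t by (simp add: p_def)
  have step: "if label a b (p t) = 2 then p (Suc u) < p (Suc t) else p (Suc t) < p (Suc u)"
    if eq: "label a b (p t) = label a b (p u)" and less: "p t < p u" for t u
  proof -
    consider "p u \<le> a" "p t \<le> a" | "a < p t" "p t \<le> b" "a < p u" "p u \<le> b"
      | "a < p t" "a < p u" "b < p t" "b < p u"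
      using eq seg(1) by (auto simp: label_def split: if_splits)
    then show ?thesis
    proof cases
      case 1
      then show ?thesis unfolding Suc using mem less
        by (auto simp: label_def intro: monotone_onD[OF seg(3)])
    next
      case 2
      then show ?thesis unfolding Suc using mem less
        by (auto simp: label_def intro: monotone_onD[OF seg(4)])
    next
      case 3
      then show ?thesis unfolding Suc using mem less
        by (auto simp: label_def intro: monotone_onD[OF seg(5)])
    qed
  qed
  show ?thesis
    unfolding signed_orbit_def
  proof (intro conjI allI impI)
    show "p 0 = 1" by (simp add: p_def)
    show "label a b (p t) \<le> label a b (p u)" if "p t < p u" for t u
      using that seg(1) by (simp add: label_def)
  qed (use bij per assms(2) step in \<open>auto simp: label_def\<close>)
qed

lemma ex_threshold:
  assumes "\<And>x y. 1 \<le> x \<Longrightarrow> x \<le> y \<Longrightarrow> y \<le> n \<Longrightarrow> P y \<Longrightarrow> P x"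
  shows "\<exists>a\<le>n. \<forall>x\<in>{1..n::nat}. P x \<longleftrightarrow> x \<le> a"
  using assms
proof (induction n)
  case (Suc n)
  show ?case
  proof (cases "P (Suc n)")
    case True
    then have "\<forall>x\<in>{1..Suc n}. P x \<longleftrightarrow> x \<le> Suc n" using Suc.prems[of _ "Suc n"] by auto
    then show ?thesis by blast
  next
    case False
    obtain a where "a \<le> n" "\<forall>x\<in>{1..n}. P x \<longleftrightarrow> x \<le> a"
      using Suc.IH Suc.prems by (metis le_Suc_eq)
    then have "\<forall>x\<in>{1..Suc n}. P x \<longleftrightarrow> x \<le> a" using False by (auto simp: le_Suc_eq)
    then show ?thesis using \<open>a \<le> n\<close> by (metis le_SucI)
  qed
qed simp

lemma ex_label:
  assumes "\<And>x y. 1 \<le> x \<Longrightarrow> x \<le> y \<Longrightarrow> y \<le> n \<Longrightarrow> g x \<le> g y" "\<And>x. g x < 3"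
  obtains a b where "a \<le> b" "b \<le> n" "\<And>x. x \<in> {1..n::nat} \<Longrightarrow> g x = label a b x"
proof -
  obtain a where a: "a \<le> n" "\<forall>x\<in>{1..n}. g x \<le> 0 \<longleftrightarrow> x \<le> a"
    using ex_threshold[of n "\<lambda>x. g x \<le> 0"] assms(1) by (metis order_trans)
  obtain b where b: "b \<le> n" "\<forall>x\<in>{1..n}. g x \<le> 1 \<longleftrightarrow> x \<le> b"
    using ex_threshold[of n "\<lambda>x. g x \<le> 1"] assms(1) by (metis order_trans)
  have "a \<le> b"
  proof (cases "a = 0")
    case False
    then have "a \<in> {1..n}" using a(1) by auto
    then show ?thesis using a(2) b(2) by (metis le_refl le_zero_eq zero_le)
  qed simp
  moreover have "g x = label a b x" if "x \<in> {1..n}" for x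
    using a(2) b(2) that assms(2)[of x] by (fastforce simp: label_def)
  ultimately show ?thesis using that b(1) by blast
qed

text \<open>The permutation sends \<open>p t\<close> to \<open>p (Suc t)\<close>. Letters increase
  weakly with the values, so two thresholds describe them, and these are the breakpoints.\<close>

lemma orbit_ex_segmentation:
  assumes so: "signed_orbit n p w"
  obtains xs a b where "xs \<in> cyclic_perms n" "(a, b) \<in> segmentations n (perm_fun xs)"
    "\<And>t. (perm_fun xs ^^ t) 1 = p t" "\<And>t. label a b (p t) = w t"
proof -
  note bij = orbit_simps(3)[OF so]
  have n: "n > 0" by (rule orbit_simps(6)[OF so])
  \<comment> \<open>\<open>r x\<close> is the time below \<open>n\<close> at which the orbit visits
    \<open>x\<close>.\<close>
  define r where "r = the_inv_into {..<n} p"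
  have pr: "p (r x) = x" if "x \<in> {1..n}" for x
    unfolding r_def using bij that by (simp add: bij_betw_def f_the_inv_into_f)
  have mem: "p t \<in> {1..n}" for t
  proof -
    have "p (t mod n) \<in> {1..n}" using bij n by (meson bij_betwE lessThan_iff mod_less_divisor)
    then show ?thesis using periodic_mod[of p n, OF orbit_simps(2)[OF so]] by simp
  qed
  have rp: "w (r (p t)) = w t" "p (Suc (r (p t))) = p (Suc t)" for t
    using orbit_eq_imp[OF so pr[OF mem], of t 0] orbit_eq_imp[OF so pr[OF mem], of t 1] by auto
  define xs where "xs = map (\<lambda>i. p (Suc (r (Suc i)))) [0..<n]"
  have f: "perm_fun xs (p t) = p (Suc t)" for t
    using mem[of t] rp(2)[of t] by (auto simp: perm_fun_def xs_def)
  have iter: "(perm_fun xs ^^ t) 1 = p t" for t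
    by (induction t) (simp_all add: f orbit_simps(1)[OF so])
  have surj: "\<exists>t. x = p t" if "x \<in> {1..n}" for x using pr[OF that] by metis
  have "set xs = {1..n}"
  proof
    show "set xs \<subseteq> {1..n}" using mem by (auto simp: xs_def)
    show "{1..n} \<subseteq> set xs"
    proof
      fix y assume "y \<in> {1..n}"
      then obtain t where t: "y = p t" using surj by blast
      obtain m where m: "n = Suc m" using n by (cases n) auto
      \<comment> \<open>Time \<open>t + m\<close> is one step before \<open>t + n\<close>, which
        avoids the predecessor of \<open>t = 0\<close>.\<close>
      have "y = perm_fun xs (p (t + m))"
        using orbit_simps(2)[OF so, of t] by (simp add: t f m)
      moreover have "p (t + m) - 1 < length xs" using mem[of "t + m"] by (auto simp: xs_def)
      ultimately show "y \<in> set xs" by (simp add: perm_fun_def)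
    qed
  qed
  moreover have "length xs = n" by (simp add: xs_def)
  moreover from calculation have "distinct xs" by (intro card_distinct) simp
  moreover have "{(perm_fun xs ^^ k) 1 |k. True} = {1..n}"
    unfolding iter using surj mem by blast
  ultimately have cyc: "xs \<in> cyclic_perms n" by (simp add: cyclic_perms_def perms_def)
  have mono: "w (r x) \<le> w (r y)" if "1 \<le> x" "x \<le> y" "y \<le> n" for x y
  proof (cases "x = y")
    case False
    then have "p (r x) < p (r y)" using pr[of x] pr[of y] that by auto
    then show ?thesis using so by (auto simp: signed_orbit_def)
  qed simp
  obtain a b where ab: "a \<le> b" "b \<le> n" "\<And>x. x \<in> {1..n} \<Longrightarrow> w (r x) = label a b x"
    using ex_label[of n "\<lambda>x. w (r x)"] mono orbit_simps(4)[OF so] by blast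
  have lab: "label a b (p t) = w t" for t using ab(3)[OF mem] rp by simp
  have step: "if label a b x = 2 then perm_fun xs y < perm_fun xs x else perm_fun xs x < perm_fun xs y"
    if xy: "x \<in> {1..n}" "y \<in> {1..n}" "label a b x = label a b y" "x < y" for x y
  proof -
    obtain t u where tu: "x = p t" "y = p u" using surj xy(1,2) by blast
    show ?thesis using so xy(3,4) unfolding tu lab f signed_orbit_def by blast
  qed
  have "(a, b) \<in> segmentations n (perm_fun xs)"
    unfolding segmentations_def
  proof (safe intro!: ab(1,2) monotone_onI)
    fix x y assume "x \<in> {0<..a}" "y \<in> {0<..a}" "x < y"
    then show "perm_fun xs x < perm_fun xs y" using step[of x y] ab(1,2) by (simp add: label_def)
  next
    fix x y assume "x \<in> {a<..b}" "y \<in> {a<..b}" "x < y"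
    then show "perm_fun xs x < perm_fun xs y" using step[of x y] ab(1,2) by (simp add: label_def)
  next
    fix x y assume "x \<in> {b<..n}" "y \<in> {b<..n}" "x < y"
    then show "perm_fun xs y < perm_fun xs x" using step[of x y] ab(1,2) by (simp add: label_def)
  qed
  then show ?thesis using that cyc iter lab by blast
qed

text \<open>If two corresponding breakpoints differ, the labels differ at the larger of them, which
  is positive.\<close>

lemma label_inject:
  assumes "a \<le> b" "b \<le> n" "a' \<le> b'" "b' \<le> n" "\<And>x. x \<in> {1..n} \<Longrightarrow> label a b x = label a' b' x"
  shows "a = a' \<and> b = b'"
proof -
  have "\<not> a < a'"
    using assms(1-4) assms(5)[of a'] by (auto simp: label_def split: if_splits)
  moreover have "\<not> a' < a"
    using assms(1-4) assms(5)[of a] by (auto simp: label_def split: if_splits)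
  moreover have "\<not> b < b'"
    using assms(1-4) assms(5)[of b'] by (auto simp: label_def split: if_splits)
  moreover have "\<not> b' < b"
    using assms(1-4) assms(5)[of b] by (auto simp: label_def split: if_splits)
  ultimately show ?thesis by simp
qed

text \<open>A segmented permutation is sent to the necklace of its word. Equal necklaces give equal
  words by minimality, then equal orbits, then equal permutations and breakpoints. Every admissible
  word is reached up to rotation.\<close>

lemma card_segmented_cyclic_perms:
  assumes "n > 0"
  shows "card (SIGMA xs:cyclic_perms n. segmentations n (perm_fun xs)) = L_star 3 n [True, True, False]"
proof -
  define A where "A = (SIGMA xs:cyclic_perms n. segmentations n (perm_fun xs))"
  define P where "P xs t = (perm_fun xs ^^ t) 1" for xs t
  define W where "W z t = (case z of (xs, a, b) \<Rightarrow> label a b (P xs t))" for z t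
  define F where "F z = necklace (map (W z) [0..<n])" for z
  have so: "signed_orbit n (P (fst z)) (W z)" if "z \<in> A" for z
    using that segmentation_orbit[of "fst z" n "fst (snd z)" "snd (snd z)"] assms
    unfolding A_def W_def P_def by (auto split: prod.splits)
  have cyc_W: "cyc (map (W z) [0..<n]) = W z" if "z \<in> A" for z
    using cyc_map_upt[of "W z" n] orbit_simps(5)[OF so[OF that]] assms by blast
  have shift: "\<exists>c. W z' = (\<lambda>t. W z (t + c))" if z: "z \<in> A" "z' \<in> A" "F z = F z'" for z z'
  proof -
    obtain j where "map (W z') [0..<n] = rotate j (map (W z) [0..<n])"
      using z(3) necklace_eq_iff unfolding F_def by blast
    then have "cyc (map (W z') [0..<n]) = (\<lambda>t. cyc (map (W z) [0..<n]) (t + j))"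
      using cyc_rotate[of "map (W z) [0..<n]" j] assms by auto
    then show ?thesis using z(1,2) by (auto simp: cyc_W)
  qed
  have "inj_on F A"
  proof (rule inj_onI)
    fix z z' assume z: "z \<in> A" "z' \<in> A" "F z = F z'"
    obtain c c' where "W z' = (\<lambda>t. W z (t + c))" "W z = (\<lambda>t. W z' (t + c'))"
      using shift[OF z] shift[OF z(2,1) z(3)[symmetric]] by blast
    then have W: "W z = W z'" using orbit_shift_eq so z(1,2) by metis
    then have P: "P (fst z) = P (fst z')" using orbit_unique so z(1,2) by metis
    obtain xs a b xs' a' b' where zz: "z = (xs, a, b)" "z' = (xs', a', b')" by (metis prod.exhaust)
    \<comment> \<open>Every point lies on the orbit, so agreement along the orbit is agreement
      everywhere.\<close>
    have surj: "\<exists>t. x = P xs t" if "x \<in> {1..n}" for x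
      using orbit_simps(3)[OF so[OF z(1)]] that unfolding zz bij_betw_def by auto
    have "perm_fun xs x = perm_fun xs' x" if x: "x \<in> {1..n}" for x
    proof -
      obtain t where t: "x = P xs t" using surj x by blast
      then have "perm_fun xs x = P xs (Suc t)" "perm_fun xs' x = P xs' (Suc t)"
        using fun_cong[OF P, of t] by (simp_all add: zz P_def)
      then show ?thesis using P zz by simp
    qed
    then have "xs ! i = xs' ! i" if "i < n" for i
      using that unfolding perm_fun_def by (metis Suc_leI add_diff_cancel_left' atLeastAtMost_iff le_add1 plus_1_eq_Suc)
    then have "xs = xs'"
      using z(1,2) unfolding zz A_def by (intro nth_equalityI) (auto simp: cyclic_perms_def perms_def)
    moreover have "label a b x = label a' b' x" if "x \<in> {1..n}" for x
      using surj[OF that] fun_cong[OF W] P unfolding zz W_def by auto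
    then have "a = a' \<and> b = b'"
      using z(1,2) unfolding zz A_def segmentations_def by (intro label_inject[of _ _ n]) auto
    ultimately show "z = z'" using zz by simp
  qed
  moreover have "F ` A = necklace ` {s \<in> words 3 n. admissible n (cyc s)}"
  proof safe
    fix xs a b assume z: "(xs, a, b) \<in> A"
    have "map (W (xs, a, b)) [0..<n] \<in> words 3 n"
      using orbit_simps(4)[OF so[OF z]] by (auto simp: words_def)
    moreover have "admissible n (cyc (map (W (xs, a, b)) [0..<n]))"
      unfolding cyc_W[OF z] by (rule orbit_admissible[OF so[OF z]])
    ultimately show "F (xs, a, b) \<in> necklace ` {s \<in> words 3 n. admissible n (cyc s)}"
      unfolding F_def by blast
  next
    fix s assume s: "s \<in> words 3 n" "admissible n (cyc s)"
    obtain p c where "signed_orbit n p (\<lambda>t. cyc s (t + c))"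
      using admissible_ex_orbit[OF s(2) assms] by blast
    then obtain xs a b where xs: "xs \<in> cyclic_perms n" "(a, b) \<in> segmentations n (perm_fun xs)"
      "\<And>t. (perm_fun xs ^^ t) 1 = p t" "\<And>t. label a b (p t) = cyc s (t + c)"
      by (rule orbit_ex_segmentation) blast
    have z: "(xs, a, b) \<in> A" using xs(1,2) by (simp add: A_def)
    have len: "length s = n" using s(1) by (simp add: words_def)
    have "W (xs, a, b) = (\<lambda>t. cyc s (t + c))" unfolding W_def P_def using xs(3,4) by auto
    then have "cyc (map (W (xs, a, b)) [0..<n]) = cyc (rotate c s)"
      unfolding cyc_W[OF z] using cyc_rotate[of s c] assms len by auto
    then have "map (W (xs, a, b)) [0..<n] = rotate c s" using len by (intro cyc_inject) auto
    then have "F (xs, a, b) = necklace s" unfolding F_def using necklace_eq_iff by metis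
    then show "necklace s \<in> F ` A" using z by (metis imageI)
  qed
  ultimately have "card A = card (necklace ` {s \<in> words 3 n. admissible n (cyc s)})"
    by (metis card_image)
  also have "{s \<in> words 3 n. admissible n (cyc s)} = {s \<in> words 3 n. primitive s \<or>
      (\<exists>q. s = q @ q \<and> primitive q \<and> odd (length (filter (\<lambda>c. c = 2) q)))}"
    using admissible_cyc_iff assms by blast
  also have "card (necklace ` \<dots>) = L_star 3 n [True, True, False]"
  proof -
    have "(\<lambda>c. c \<in> {i. i < length [True, True, False] \<and> \<not> [True, True, False] ! i}) = (\<lambda>c. c = 2)"
      by (auto simp: fun_eq_iff less_Suc_eq numeral_2_eq_2)
    then have "o_sigma [True, True, False] q = length (filter (\<lambda>c. c = 2) q)" for q
      by (simp only: o_sigma_def)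
    then show ?thesis
      unfolding card_necklaces_with_squares L_star_def L_def L_sigma_def prim_necklaces_def by simp
  qed
  finally show ?thesis unfolding A_def .
qed

section \<open>Number of segmentations\<close>

text \<open>The list positions \<open>a, ..., b - 1\<close> counted from zero are the arguments
  \<open>a + 1, ..., b\<close> of \<open>perm_fun\<close>, hence the half-open interval.\<close>

lemma sorted_segment_iff:
  assumes "b \<le> length xs"
  shows "sorted_wrt R (segment xs a b) \<longleftrightarrow> monotone_on {a<..b} (<) R (perm_fun xs)"
proof -
  have "sorted_wrt R (segment xs a b) \<longleftrightarrow>
      (\<forall>i j. i < j \<longrightarrow> j < b - a \<longrightarrow> R (xs ! (a + i)) (xs ! (a + j)))"
    unfolding sorted_wrt_iff_nth_less segment_def using assms by auto
  also have "\<dots> \<longleftrightarrow> (\<forall>x y. a < x \<longrightarrow> x < y \<longrightarrow> y \<le> b \<longrightarrow> R (xs ! (x - 1)) (xs ! (y - 1)))"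
  proof safe
    fix x y assume h: "\<forall>i j. i < j \<longrightarrow> j < b - a \<longrightarrow> R (xs ! (a + i)) (xs ! (a + j))"
      and "a < x" "x < y" "y \<le> b"
    then show "R (xs ! (x - 1)) (xs ! (y - 1))"
      using h[rule_format, of "x - 1 - a" "y - 1 - a"] by simp
  next
    fix i j assume h: "\<forall>x y. a < x \<longrightarrow> x < y \<longrightarrow> y \<le> b \<longrightarrow> R (xs ! (x - 1)) (xs ! (y - 1))"
      and "i < j" "j < b - a"
    then show "R (xs ! (a + i)) (xs ! (a + j))"
      using h[rule_format, of "Suc (a + i)" "Suc (a + j)"] by simp
  qed
  also have "\<dots> \<longleftrightarrow> monotone_on {a<..b} (<) R (perm_fun xs)"
    unfolding monotone_on_def perm_fun_def by auto
  finally show ?thesis .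
qed

lemma shape_ppm_iff:
  "xs \<in> shape_perms [True, True, False] n \<longleftrightarrow> xs \<in> perms n \<and> segmentations n (perm_fun xs) \<noteq> {}"
proof (cases "xs \<in> perms n")
  case True
  then have len: "length xs = n" by (simp add: perms_def)
  show ?thesis
  proof
    assume "xs \<in> shape_perms [True, True, False] n"
    then obtain e :: "nat \<Rightarrow> nat" where "e 0 = 0" "e 3 = n" "e 0 \<le> e 1" "e 1 \<le> e 2" "e 2 \<le> e 3"
      "sorted_wrt (<) (segment xs (e 0) (e 1))" "sorted_wrt (<) (segment xs (e 1) (e 2))"
      "sorted_wrt (>) (segment xs (e 2) (e 3))"
      unfolding shape_perms_def by (auto simp: All_less_Suc numeral_3_eq_3 numeral_2_eq_2)
    then have "(e 1, e 2) \<in> segmentations n (perm_fun xs)"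
      unfolding segmentations_def using len by (simp add: sorted_segment_iff)
    then show "xs \<in> perms n \<and> segmentations n (perm_fun xs) \<noteq> {}" using True by blast
  next
    assume "xs \<in> perms n \<and> segmentations n (perm_fun xs) \<noteq> {}"
    then obtain a b where "a \<le> b" "b \<le> n" "strict_mono_on {0<..a} (perm_fun xs)"
      "strict_mono_on {a<..b} (perm_fun xs)" "strict_antimono_on {b<..n} (perm_fun xs)"
      unfolding segmentations_def by blast
    then show "xs \<in> shape_perms [True, True, False] n"
      unfolding shape_perms_def using True len
      by (auto simp: All_less_Suc sorted_segment_iff
          intro!: exI[of _ "\<lambda>i. if i = 0 then 0 else if i = 1 then a else if i = 2 then b else n"])
  qed
qed (simp add: shape_perms_def)

lemma shape_pm_iff:
  "xs \<in> shape_perms [True, False] n \<longleftrightarrow> xs \<in> perms n \<and>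
    (\<exists>b\<le>n. strict_mono_on {0<..b} (perm_fun xs) \<and> strict_antimono_on {b<..n} (perm_fun xs))"
proof (cases "xs \<in> perms n")
  case True
  then have len: "length xs = n" by (simp add: perms_def)
  show ?thesis
  proof
    assume "xs \<in> shape_perms [True, False] n"
    then obtain e :: "nat \<Rightarrow> nat" where "e 0 = 0" "e 2 = n" "e 0 \<le> e 1" "e 1 \<le> e 2"
      "sorted_wrt (<) (segment xs (e 0) (e 1))" "sorted_wrt (>) (segment xs (e 1) (e 2))"
      unfolding shape_perms_def by (auto simp: All_less_Suc numeral_2_eq_2)
    then show "xs \<in> perms n \<and> (\<exists>b\<le>n. strict_mono_on {0<..b} (perm_fun xs) \<and>
        strict_antimono_on {b<..n} (perm_fun xs))"
      using True len by (auto simp: sorted_segment_iff)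
  next
    assume "xs \<in> perms n \<and> (\<exists>b\<le>n. strict_mono_on {0<..b} (perm_fun xs) \<and>
        strict_antimono_on {b<..n} (perm_fun xs))"
    then obtain b where "b \<le> n" "strict_mono_on {0<..b} (perm_fun xs)"
      "strict_antimono_on {b<..n} (perm_fun xs)" by blast
    then show "xs \<in> shape_perms [True, False] n"
      unfolding shape_perms_def using True len
      by (auto simp: All_less_Suc sorted_segment_iff
          intro!: exI[of _ "\<lambda>i. if i = 0 then 0 else if i = 1 then b else n"])
  qed
qed (simp add: shape_perms_def)

section \<open>Peaks and the possible breakpoints\<close>

text \<open>The maximum ends the increasing run or starts the decreasing one. It fits into either
  run, so both choices of breakpoint are valid.\<close>

lemma unimodal_peak:
  fixes f :: "nat \<Rightarrow> nat"
  assumes "d \<le> b" "b \<le> n" and inc: "strict_mono_on {d<..b} f" and dec: "strict_antimono_on {b<..n} f"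
    and p: "d < p" "p \<le> n" and max: "\<And>x. d < x \<Longrightarrow> x \<le> n \<Longrightarrow> x \<noteq> p \<Longrightarrow> f x < f p"
  shows "strict_mono_on {d<..p} f" "strict_antimono_on {p - 1<..n} f" "b = p - 1 \<or> b = p"
proof -
  have inc': "f x < f y" if "d < x" "x < y" "y \<le> b" for x y
    using monotone_onD[OF inc] that by simp
  have dec': "f y < f x" if "b < x" "x < y" "y \<le> n" for x y
    using monotone_onD[OF dec] that by simp
  have "\<not> p < b"
    using inc'[of p b] max[of b] assms(1,2) p by fastforce
  moreover have "\<not> Suc b < p"
    using dec'[of "Suc b" p] max[of "Suc b"] assms(1,2) p by fastforce
  ultimately show b: "b = p - 1 \<or> b = p" by linarith
  show "strict_mono_on {d<..p} f"
  proof (rule monotone_onI)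
    fix x y assume "x \<in> {d<..p}" "y \<in> {d<..p}" "x < y"
    then show "f x < f y" using b max[of x] inc'[of x y] p by (cases "y = p") auto
  qed
  show "strict_antimono_on {p - 1<..n} f"
  proof (rule monotone_onI)
    fix x y assume "x \<in> {p - 1<..n}" "y \<in> {p - 1<..n}" "x < y"
    then show "f y < f x" using b max[of y] dec'[of x y] p by (cases "x = p") auto
  qed
qed

lemma segmentations_unimodal:
  fixes f :: "nat \<Rightarrow> nat"
  assumes i: "2 \<le> i" "i < n" and inc: "strict_mono_on {0<..i} f"
    and dec: "strict_antimono_on {i - 1<..n} f"
  shows "card (segmentations n f) = 2 * i + 2"
proof -
  have inc': "f x < f y" if "0 < x" "x < y" "y \<le> i" for x y
    using monotone_onD[OF inc] that by simp
  have dec': "f y < f x" if "i \<le> x" "x < y" "y \<le> n" for x y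
    using monotone_onD[OF dec] that i by simp
  have "segmentations n f = (\<lambda>a. (a, i - 1)) ` {..i - 1} \<union> (\<lambda>a. (a, i)) ` {..i} \<union> {(i, Suc i)}"
    (is "_ = ?R")
  proof
    show "segmentations n f \<subseteq> ?R"
    proof
      fix z assume "z \<in> segmentations n f"
      then obtain a b where z: "z = (a, b)" "a \<le> b" "b \<le> n" and m1: "strict_mono_on {0<..a} f"
        and m2: "strict_mono_on {a<..b} f" and m3: "strict_antimono_on {b<..n} f"
        unfolding segmentations_def by blast
      \<comment> \<open>The ascent from \<open>i - 1\<close> to \<open>i\<close> cannot lie in the
        decreasing segment, and the descents from \<open>i\<close> and \<open>Suc i\<close> cannot
        lie in an increasing one. Past the peak, the second segment is thus the single position
        \<open>Suc i\<close>.\<close>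
      have n1: "\<not> b < i - 1"
        using monotone_onD[OF m3, of "i - 1" i] inc'[of "i - 1" i] i by fastforce
      have n2: "\<not> (a < i \<and> i < b)"
        using monotone_onD[OF m2, of i "Suc i"] dec'[of i "Suc i"] i by fastforce
      have n3: "\<not> i < a"
        using monotone_onD[OF m1, of i "Suc i"] dec'[of i "Suc i"] i by fastforce
      have n4: "\<not> (a = i \<and> Suc i < b)"
        using monotone_onD[OF m2, of "Suc i" "Suc (Suc i)"] dec'[of "Suc i" "Suc (Suc i)"] z(3) by fastforce
      consider "b = i - 1" | "b = i" | "i < b" using n1 by linarith
      then show "z \<in> ?R"
      proof cases
        case 3
        then have "a = i" "b = Suc i" using n2 n3 n4 by linarith+
        then show ?thesis using z by simp
      qed (use z in auto)
    qed
    show "?R \<subseteq> segmentations n f"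
      unfolding segmentations_def using i
      by (auto simp: monotone_on_def inc' dec')
  qed
  also have "card \<dots> = Suc (i - 1) + Suc i + 1"
    using i by (subst card_Un_disjoint; (subst card_Un_disjoint)?) (auto simp: card_image inj_on_def)
  finally show ?thesis using i by simp
qed

text \<open>There is a descent from \<open>d\<close> to \<open>Suc d\<close>, followed by an ascent.
  A first breakpoint beyond \<open>d\<close> puts the descent into the first segment; one before
  \<open>d\<close> forces \<open>b <= d\<close> and puts the ascent into the decreasing segment.
  Only the side to which the later peak \<open>p\<close> belongs is free.\<close>

lemma segmentations_not_unimodal:
  fixes f :: "nat \<Rightarrow> nat"
  assumes inj: "inj_on f {1..n}" and "segmentations n f \<noteq> {}"
    and not: "\<not> (\<exists>b\<le>n. strict_mono_on {0<..b} f \<and> strict_antimono_on {b<..n} f)"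
  shows "card (segmentations n f) = 2"
proof -
  obtain d b where db: "d \<le> b" "b \<le> n" and m1: "strict_mono_on {0<..d} f"
    and m2: "strict_mono_on {d<..b} f" and m3: "strict_antimono_on {b<..n} f"
    using assms(2) unfolding segmentations_def by blast
  have "d < n"
  proof (rule ccontr)
    assume "\<not> d < n"
    then have "strict_mono_on {0<..n} f" "strict_antimono_on {n<..n} f"
      using m1 db by (auto simp: monotone_on_def)
    then show False using not by blast
  qed
  then have fin: "finite (f ` {d<..n})" "f ` {d<..n} \<noteq> {}" by auto
  obtain p where p: "d < p" "p \<le> n" "f p = Max (f ` {d<..n})"
    using Max_in[OF fin] by (metis greaterThanAtMost_iff imageE)
  have max: "f x < f p" if "d < x" "x \<le> n" "x \<noteq> p" for x
  proof -
    have "f x \<le> f p" using Max_ge[OF fin(1)] that p(3) by simp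
    moreover have "f x \<noteq> f p" using inj_onD[OF inj, of x p] that p by auto
    ultimately show ?thesis by simp
  qed
  have inc: "strict_mono_on {d<..p} f" and dec: "strict_antimono_on {p - 1<..n} f"
    using unimodal_peak[OF db m2 m3 p(1,2) max] by auto
  have inc': "f x < f y" if "d < x" "x < y" "y \<le> p" for x y
    using monotone_onD[OF inc] that by simp
  \<comment> \<open>A peak directly after \<open>d\<close> would leave only a decreasing run there,
    making \<open>f\<close> unimodal with breakpoint \<open>d\<close>.\<close>
  have d2: "Suc d < p"
  proof (rule ccontr)
    assume "\<not> Suc d < p"
    then have "p - 1 = d" using p by simp
    then show False using dec m1 not db by auto
  qed
  \<comment> \<open>Without this descent the two increasing runs join into one ending at
    \<open>p\<close>.\<close>
  have desc: "d > 0 \<and> f (Suc d) < f d"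
  proof (rule ccontr)
    assume a: "\<not> (d > 0 \<and> f (Suc d) < f d)"
    have asc: "f d < f (Suc d)" if "d > 0"
      using a that inj_onD[OF inj, of d "Suc d"] \<open>d < n\<close> by fastforce
    have "strict_mono_on {0<..p} f"
    proof (rule monotone_onI)
      fix x y assume xy: "x \<in> {0<..p}" "y \<in> {0<..p}" "x < y"
      show "f x < f y"
      proof (cases "d < x \<or> y \<le> d")
        case True
        then show ?thesis using xy inc' monotone_onD[OF m1, of x y] by auto
      next
        case False
        have "f x \<le> f d" using monotone_onD[OF m1, of x d] False xy by (cases "x = d") auto
        also have "f d < f (Suc d)" using asc False xy by auto
        also have "f (Suc d) \<le> f y" using inc'[of "Suc d" y] False xy by (cases "y = Suc d") auto
        finally show ?thesis .
      qed
    qed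
    moreover have "strict_antimono_on {p<..n} f"
      using dec p by (auto simp: monotone_on_def)
    ultimately show False using not p(2) by blast
  qed
  have "segmentations n f = {(d, p - 1), (d, p)}"
  proof
    show "segmentations n f \<subseteq> {(d, p - 1), (d, p)}"
    proof
      fix z assume "z \<in> segmentations n f"
      then obtain a b where z: "z = (a, b)" "a \<le> b" "b \<le> n" and m1: "strict_mono_on {0<..a} f"
        and m2: "strict_mono_on {a<..b} f" and m3: "strict_antimono_on {b<..n} f"
        unfolding segmentations_def by blast
      have "\<not> d < a"
        using monotone_onD[OF m1, of d "Suc d"] desc by fastforce
      moreover have "\<not> a < d"
      proof
        assume "a < d"
        then have "b \<le> d" using monotone_onD[OF m2, of d "Suc d"] desc by fastforce
        then show False
          using monotone_onD[OF m3, of "Suc d" "Suc (Suc d)"] inc'[of "Suc d" "Suc (Suc d)"] d2 p(2)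
          by fastforce
      qed
      ultimately have "a = d" by simp
      then show "z \<in> {(d, p - 1), (d, p)}"
        using unimodal_peak(3)[OF _ z(3) _ m3 p(1,2) max] m2 z by auto
    qed
    have "strict_mono_on {d<..p - 1} f" "strict_antimono_on {p<..n} f"
      using inc dec by (auto simp: monotone_on_def)
    then show "{(d, p - 1), (d, p)} \<subseteq> segmentations n f"
      unfolding segmentations_def using m1 inc dec p d2 by auto
  qed
  moreover have "p - 1 \<noteq> p" using p by simp
  ultimately show ?thesis by simp
qed

text \<open>A peak at \<open>n\<close> makes \<open>n\<close> a fixed point; a peak at
  \<open>1\<close> makes the permutation decreasing, so it swaps \<open>1\<close> and
  \<open>n\<close>. Both give a proper invariant set containing \<open>1\<close>, impossible for a
  cycle of length at least 3. Thus the sum over \<open>2..n-1\<close> misses no unimodal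
  permutation.\<close>

lemma cyclic_unimodal_peak:
  assumes "xs \<in> cyclic_shape_perms [True, False] n" "n \<ge> 3"
  obtains i where "i \<in> {2..n - 1}" "perm_fun xs i = n"
proof -
  define f where "f = perm_fun xs"
  have orb: "{(f ^^ k) 1 |k. True} = {1..n}" and "xs \<in> perms n"
    using assms(1) by (auto simp: cyclic_shape_perms_def cyclic_perms_def f_def)
  then have inj: "inj_on f {1..n}" and im: "f ` {1..n} = {1..n}"
    using perm_fun_bij[of xs n] by (auto simp: bij_betw_def f_def)
  have le: "f x \<in> {1..n}" if "x \<in> {1..n}" for x using im that by blast
  have small: False if "f ` B \<subseteq> B" "1 \<in> B" "card B < n" "finite B" for B
  proof -
    have "(f ^^ t) 1 \<in> B" for t by (induction t) (use that(1,2) in auto)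
    then have "{1..n} \<subseteq> B" unfolding orb[symmetric] by auto
    then show False using card_mono[OF that(4), of "{1..n}"] that(3) by simp
  qed
  obtain i where i: "i \<in> {1..n}" "f i = n"
  proof -
    have "n \<in> f ` {1..n}" unfolding im using assms(2) by simp
    then show ?thesis using that by blast
  qed
  have max: "f x < f i" if "0 < x" "x \<le> n" "x \<noteq> i" for x
  proof -
    have "x \<in> {1..n}" using that by simp
    then show ?thesis using le[of x] inj_onD[OF inj, of x i] i that(3) by fastforce
  qed
  have "\<exists>b\<le>n. strict_mono_on {0<..b} f \<and> strict_antimono_on {b<..n} f"
    using assms(1) by (simp add: cyclic_shape_perms_def shape_pm_iff f_def)
  then obtain b where b: "b \<le> n" "strict_mono_on {0<..b} f" "strict_antimono_on {b<..n} f"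
    by (elim exE conjE)
  have "i \<noteq> n"
  proof
    assume "i = n"
    then have "f ` {1..<n} \<subseteq> {1..<n}" using le max i by fastforce
    then show False using small[of "{1..<n}"] assms(2) by simp
  qed
  moreover have "i \<noteq> 1"
  proof
    assume "i = 1"
    obtain j where j: "j \<in> {1..n}" "f j = 1"
    proof -
      have "1 \<in> f ` {1..n}" unfolding im using assms(2) by simp
      then show ?thesis using that by auto
    qed
    have "strict_antimono_on {0<..n} f"
      using unimodal_peak(2)[OF _ b, of i] max i(1) \<open>i = 1\<close> by simp
    then have "f n < f j" if "j \<noteq> n"
      using monotone_onD[of "{0<..n}" "(<)" "(>)" f j n] j that by auto
    then have "f n = 1" using j le[of n] assms(2) by (cases "j = n") auto
    then show False using small[of "{1, n}"] i \<open>i = 1\<close> assms(2) by (auto simp: card_insert_if)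
  qed
  ultimately show ?thesis using that[of i] i by (auto simp: f_def)
qed

lemma finite_perms: "finite (perms n)"
proof (rule finite_subset)
  show "perms n \<subseteq> {xs. set xs \<subseteq> {1..n} \<and> length xs = n}" by (auto simp: perms_def)
qed (simp add: finite_lists_length_eq)

lemma card_segmentations_cyclic_unimodal:
  assumes "xs \<in> cyclic_shape_perms [True, False] n" "i \<in> {2..n - 1}" "perm_fun xs i = n"
  shows "card (segmentations n (perm_fun xs)) = 2 * i + 2"
proof -
  define f where "f = perm_fun xs"
  have "xs \<in> perms n" using assms(1) by (auto simp: cyclic_shape_perms_def cyclic_perms_def)
  then have inj: "inj_on f {1..n}" and im: "f ` {1..n} = {1..n}"
    using perm_fun_bij[of xs n] by (auto simp: bij_betw_def f_def)
  have max: "f x < f i" if "0 < x" "x \<le> n" "x \<noteq> i" for x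
  proof -
    have "x \<in> {1..n}" "i \<in> {1..n}" using that assms(2) by auto
    moreover from this im have "f x \<in> {1..n}" by blast
    ultimately show ?thesis using inj_onD[OF inj, of x i] assms(3) that(3) by (fastforce simp: f_def)
  qed
  have "\<exists>b\<le>n. strict_mono_on {0<..b} f \<and> strict_antimono_on {b<..n} f"
    using assms(1) by (simp add: cyclic_shape_perms_def shape_pm_iff f_def)
  then obtain b where b: "b \<le> n" "strict_mono_on {0<..b} f" "strict_antimono_on {b<..n} f"
    by (elim exE conjE)
  have "strict_mono_on {0<..i} f" "strict_antimono_on {i - 1<..n} f"
    using unimodal_peak(1,2)[OF _ b, of i] max assms(2) by auto
  then show ?thesis using segmentations_unimodal[of i n f] assms(2) by (auto simp: f_def)
qed

lemma finite_segmentations: "finite (segmentations n f)"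
  by (rule finite_subset[of _ "{..n} \<times> {..n}"]) (auto simp: segmentations_def)

theorem theorem4p5:
  fixes n :: nat
  assumes "n \<ge> 3"
  shows "real (c5 n) = real (L_star 3 n [True, True, False]) / 2
           - (\<Sum>i = 2..n-1. real i * real (Lambda n i))"
proof -
  define C where "C = cyclic_shape_perms [True, True, False] n"
  define U where "U = cyclic_shape_perms [True, False] n"
  define V where "V i = {xs \<in> U. perm_fun xs i = n}" for i
  define g where "g xs = card (segmentations n (perm_fun xs))" for xs
  have C: "C = {xs \<in> cyclic_perms n. segmentations n (perm_fun xs) \<noteq> {}}"
    unfolding C_def cyclic_shape_perms_def by (auto simp: shape_ppm_iff cyclic_perms_def)
  have fin: "finite (cyclic_perms n)"
    using finite_perms[of n] by (simp add: cyclic_perms_def)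
  then have finC: "finite C" by (simp add: C)
  have finU: "finite U" using fin by (simp add: U_def cyclic_shape_perms_def)
  have UC: "U \<subseteq> C"
  proof
    fix xs assume xs: "xs \<in> U"
    then obtain i where "i \<in> {2..n - 1}" "perm_fun xs i = n"
      using cyclic_unimodal_peak[of xs n] assms unfolding U_def by blast
    then have "card (segmentations n (perm_fun xs)) \<noteq> 0"
      using card_segmentations_cyclic_unimodal[of xs n i] xs by (simp add: U_def)
    then have "segmentations n (perm_fun xs) \<noteq> {}" by auto
    then show "xs \<in> C" using xs by (simp add: C U_def cyclic_shape_perms_def)
  qed
  have U: "U = (\<Union>i\<in>{2..n - 1}. V i)"
    using cyclic_unimodal_peak[of _ n] assms unfolding U_def V_def by blast
  have disj: "V i \<inter> V j = {}" if "i \<in> {2..n - 1}" "j \<in> {2..n - 1}" "i \<noteq> j" for i j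
  proof -
    have False if "xs \<in> V i" "xs \<in> V j" for xs
    proof -
      have "inj_on (perm_fun xs) {1..n}"
        using that perm_fun_bij[of xs n]
        by (auto simp: V_def U_def cyclic_shape_perms_def cyclic_perms_def bij_betw_def)
      then have "i = j"
        using that \<open>i \<in> {2..n - 1}\<close> \<open>j \<in> {2..n - 1}\<close>
        by (intro inj_onD[of "perm_fun xs" "{1..n}" i j]) (auto simp: V_def)
      then show False using \<open>i \<noteq> j\<close> by simp
    qed
    then show ?thesis by blast
  qed
  have sumU: "sum h U = (\<Sum>i = 2..n - 1. sum h (V i))" for h :: "nat list \<Rightarrow> nat"
    unfolding U
    by (rule sum.UNION_disjoint) (use finU disj in \<open>auto simp: V_def\<close>)
  have V: "card (V i) = Lambda n i" for i by (simp add: Lambda_def V_def U_def)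
  have "L_star 3 n [True, True, False] = card (SIGMA xs:cyclic_perms n. segmentations n (perm_fun xs))"
    using card_segmented_cyclic_perms[of n] assms by simp
  also have "\<dots> = sum g (cyclic_perms n)"
    unfolding g_def using fin finite_segmentations by (intro card_SigmaI) auto
  also have "\<dots> = sum g C"
    by (rule sum.mono_neutral_right) (auto simp: fin C g_def)
  also have "\<dots> = sum g (C - U) + sum g U"
    using sum.subset_diff[OF UC finC] .
  also have "sum g (C - U) = (\<Sum>xs\<in>C - U. 2)"
  proof (rule sum.cong)
    fix xs assume xs: "xs \<in> C - U"
    then have "xs \<in> cyclic_perms n" "xs \<in> perms n" by (auto simp: C cyclic_perms_def)
    moreover from this have "inj_on (perm_fun xs) {1..n}"
      using perm_fun_bij by (simp add: bij_betw_def)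
    ultimately show "g xs = 2"
      unfolding g_def using xs
      by (intro segmentations_not_unimodal) (auto simp: C U_def cyclic_shape_perms_def shape_pm_iff)
  qed simp
  also have "\<dots> = 2 * (card C - card U)"
    using card_Diff_subset[OF finU UC] by simp
  also have "sum g U = (\<Sum>i = 2..n - 1. (2 * i + 2) * Lambda n i)"
    unfolding sumU
  proof (rule sum.cong)
    fix i assume i: "i \<in> {2..n - 1}"
    have "g xs = 2 * i + 2" if "xs \<in> V i" for xs
      using card_segmentations_cyclic_unimodal[OF _ i, of xs] that by (simp add: g_def V_def U_def)
    then show "sum g (V i) = (2 * i + 2) * Lambda n i" by (simp add: V)
  qed simp
  finally have main: "L_star 3 n [True, True, False] =
      2 * (c5 n - card U) + (\<Sum>i = 2..n - 1. (2 * i + 2) * Lambda n i)"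
    by (simp add: c5_def C_def)
  \<comment> \<open>The additional \<open>2\<close> in each factor \<open>2 * i + 2\<close> sums to
    \<open>2 * card U\<close>, which restores the unimodal permutations removed from
    \<open>C\<close>.\<close>
  have "card U = (\<Sum>i = 2..n - 1. Lambda n i)"
    using sumU[of "\<lambda>_. 1"] by (simp add: V)
  then have "(\<Sum>i = 2..n - 1. (2 * i + 2) * Lambda n i) =
      2 * (\<Sum>i = 2..n - 1. i * Lambda n i) + 2 * card U"
    by (simp add: sum_distrib_left sum.distrib algebra_simps)
  \<comment> \<open>This makes the natural-number difference in \<open>main\<close> a true
    one.\<close>
  moreover have "card U \<le> c5 n" using card_mono[OF finC UC] by (simp add: c5_def C_def)
  ultimately have "L_star 3 n [True, True, False] = 2 * c5 n + 2 * (\<Sum>i = 2..n - 1. i * Lambda n i)"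
    using main by simp
  then show ?thesis by (simp add: add_divide_distrib)
qed

end
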